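(* Let $p$ be a prime, $q=p^l$, $n\ge 2$ and $k\ge 1$ integers, and assume $(n,q)\notin\{(2,2),(2,3)\}$. Let $g\in SL_n(\mathbb F_q)\setminus Z_{n,q}$. Then: (a) $P_{k,n,q}=M_n(\mathbb F_q)$ if and only if $g\in L_{P_{k,n,q}}$. (b) If $p\nmid k$ and $-1\in\{x^d\mid x\in\mathbb F_q\}$, where $d=\gcd(k,q-1)$, then $Q_{k,n,q}=M_n(\mathbb F_q)$ if and only if $g\in L_{Q_{k,n,q}}$. (c) If $p\nmid k$, then $Q_{k,n,q}\cup\{0_n\}=M_n(\mathbb F_q)$ if and only if $g\in L_{Q_{k,n,q}}$.
   Context: $Z_{n,q}=\{aI_n\mid a\in\mathbb F_q,\ a^n=1\}$ is the center of $SL_n(\mathbb F_q)$. $P_{k,n,q}=\{A^k+B^k\mid A,B\in M_n(\mathbb F_q)\}$ and $Q_{k,n,q}=\{A^k+B^k\mid A,B\in GL_n(\mathbb F_q)\}$. For a nonempty subset $S\subset M_n(\mathbb F_q)$, $L_S=\{g\in GL_n(\mathbb F_q)\mid gS=S\}$, where $gS=\{gs\mid s\in S\}$. *)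

theory Defs
  imports "Jordan_Normal_Form.Determinant" "HOL-Library.Cardinality" "HOL-Computational_Algebra.Primes"
begin

text \<open>The finite field \<open>\<F>\<^sub>q\<close> is a type \<open>'a :: {field, finite}\<close> of cardinality \<open>q\<close>; the index \<open>q\<close> of
  the sets below is carried by their type.\<close>

definition GL :: "nat \<Rightarrow> 'a :: {field, finite} mat set" where
  "GL n = {A \<in> carrier_mat n n. invertible_mat A}"

definition SL :: "nat \<Rightarrow> 'a :: {field, finite} mat set" where
  "SL n = {A \<in> carrier_mat n n. det A = 1}"

definition SL_center :: "nat \<Rightarrow> 'a :: {field, finite} mat set" where
  "SL_center n = {a \<cdot>\<^sub>m 1\<^sub>m n | a. a ^ n = 1}"

definition P_set :: "nat \<Rightarrow> nat \<Rightarrow> 'a :: {field, finite} mat set" where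
  "P_set k n = {A ^\<^sub>m k + B ^\<^sub>m k | A B. A \<in> carrier_mat n n \<and> B \<in> carrier_mat n n}"

definition Q_set :: "nat \<Rightarrow> nat \<Rightarrow> 'a :: {field, finite} mat set" where
  "Q_set k n = {A ^\<^sub>m k + B ^\<^sub>m k | A B. A \<in> GL n \<and> B \<in> GL n}"

definition left_stabilizer :: "nat \<Rightarrow> 'a :: {field, finite} mat set \<Rightarrow> 'a mat set" where
  "left_stabilizer n S = {g \<in> GL n. {g * s | s. s \<in> S} = S}"

end

theory Submission imports Defs begin

text \<open>
  The left stabilizer of a conjugation invariant set \<open>S\<close> is normal in \<open>GL\<^sub>n\<close>. If it contains a nonscalar
  matrix \<open>g\<close>, commutators with \<open>g\<close> produce a transvection, and since all transvections are conjugate, it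
  contains all of them. As \<open>S\<close> is also invariant under transposition, membership in \<open>S\<close> is unchanged
  by row and by column operations that add multiples of one line to the others.

  By such operations every matrix becomes a partial identity matrix, which is idempotent, or
  \<open>diag (1, \<dots>, 1, \<delta>)\<close>, which is equivalent to a sum of two idempotents; idempotents are \<open>k\<close>-th powers.
  Similarly, every nonzero matrix becomes one with all diagonal entries \<open>2\<close>. This is the sum of a lower
  and an upper unitriangular matrix, which have \<open>p\<close>-power order and hence are \<open>k\<close>-th powers of invertible
  matrices if \<open>p\<close> does not divide \<open>k\<close>.
\<close>

section \<open>Transvections\<close>

text \<open>Over the fields with 2 and 3 elements, \<open>SL 2\<close> has noncentral normal
  subgroups (of orders 3 and 8) without transvections. This is why n = 2 needs an r with r \<noteq>
  0 and r^2 \<noteq> 1: the commutators available there produce a transvection with coefficient r^2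
  - 1. Normality under all of \<open>GL n\<close>, not only \<open>SL n\<close>, is exploited twice:
  dilations of determinant different from 1 enter the commutators, and all nontrivial transvections
  form one class even for n = 2. The operations obtained preserve the determinant and cannot rescale
  a line. Hence a pivot can only be set to 1 with the help of a nonzero entry in another column, and
  the last diagonal entry \<delta> of an invertible matrix stays arbitrary, which calls for a
  separate 2 x 2 decomposition. Idempotents are powers for every k but are invertible only when
  equal to the identity; so \<open>Q_set\<close> needs unipotent summands and the condition on p.
  The zero matrix is fixed by all operations, so its membership in \<open>Q_set\<close> is a
  separate question, settled by a k-th root of -1.\<close>

text \<open>The matrix \<open>I + x f\<^sup>T\<close>; it is not required that \<open>f \<bullet> x = 0\<close>, so general dilations are included.\<close>

definition transvection :: "'a::field vec \<Rightarrow> 'a vec \<Rightarrow> 'a mat" where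
  "transvection x f = mat (dim_vec x) (dim_vec x) (\<lambda>(i, j). (if i = j then 1 else 0) + x $ i * f $ j)"

lemma transvection_carrier [simp]:
  "x \<in> carrier_vec n \<Longrightarrow> transvection x f \<in> carrier_mat n n"
  unfolding transvection_def by auto

lemma transvection_transpose:
  assumes "x \<in> carrier_vec n" "f \<in> carrier_vec n"
  shows "(transvection x f)\<^sup>T = transvection f x"
  using assms by (intro eq_matI) (auto simp: transvection_def)

lemma transvection_mult_vec:
  fixes x :: "'a::field vec"
  assumes "x \<in> carrier_vec n" "f \<in> carrier_vec n" "y \<in> carrier_vec n"
  shows "transvection x f *\<^sub>v y = y + (f \<bullet> y) \<cdot>\<^sub>v x"
proof (rule eq_vecI)
  fix i assume "i < dim_vec (y + (f \<bullet> y) \<cdot>\<^sub>v x)"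
  then have i: "i < n" using assms by simp
  have "(transvection x f *\<^sub>v y) $ i = (\<Sum>j<n. (if j = i then y $ j else 0) + x $ i * (f $ j * y $ j))"
    using assms i
    by (auto simp: transvection_def scalar_prod_def lessThan_atLeast0 algebra_simps intro!: sum.cong)
  also have "\<dots> = (y + (f \<bullet> y) \<cdot>\<^sub>v x) $ i"
    using assms i
    by (simp add: sum.distrib scalar_prod_def lessThan_atLeast0 flip: sum_distrib_left)
  finally show "(transvection x f *\<^sub>v y) $ i = (y + (f \<bullet> y) \<cdot>\<^sub>v x) $ i" .
qed (use assms in \<open>auto simp: transvection_def\<close>)

lemma eq_mat_on_vecs:
  fixes A B :: "'a::comm_ring_1 mat"
  assumes A: "A \<in> carrier_mat n m" and B: "B \<in> carrier_mat n m"
    and eq: "\<And>y. y \<in> carrier_vec m \<Longrightarrow> A *\<^sub>v y = B *\<^sub>v y"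
  shows "A = B"
proof (rule eq_matI)
  fix i j assume ij: "i < dim_row B" "j < dim_col B"
  have "(A *\<^sub>v unit_vec m j) $ i = (B *\<^sub>v unit_vec m j) $ i" using eq by simp
  then show "A $$ (i, j) = B $$ (i, j)" using ij A B by simp
qed (use A B in auto)

lemma transvection_mult:
  fixes x :: "'a::field vec"
  assumes x: "x \<in> carrier_vec n" and y: "y \<in> carrier_vec n" and f: "f \<in> carrier_vec n"
  shows "transvection x f * transvection y f = transvection (x + y + (f \<bullet> y) \<cdot>\<^sub>v x) f"
proof (rule eq_mat_on_vecs[of _ n n])
  fix v :: "'a vec" assume v: "v \<in> carrier_vec n"
  have "(transvection x f * transvection y f) *\<^sub>v v
      = v + (f \<bullet> v) \<cdot>\<^sub>v y + (f \<bullet> (v + (f \<bullet> v) \<cdot>\<^sub>v y)) \<cdot>\<^sub>v x"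
    using assms v
    by (simp add: assoc_mult_mat_vec[OF transvection_carrier transvection_carrier] transvection_mult_vec[of _ n])
  also have "f \<bullet> (v + (f \<bullet> v) \<cdot>\<^sub>v y) = f \<bullet> v + (f \<bullet> v) * (f \<bullet> y)"
    using assms v by (simp add: scalar_prod_add_distrib[of _ n])
  finally show "(transvection x f * transvection y f) *\<^sub>v v
      = transvection (x + y + (f \<bullet> y) \<cdot>\<^sub>v x) f *\<^sub>v v"
    using assms v
    by (subst transvection_mult_vec[of _ n]) (auto intro!: eq_vecI simp: algebra_simps)
qed (use assms in \<open>simp_all add: mult_carrier_mat[of _ n n _ n]\<close>)

lemma transvection_zero: "transvection (0\<^sub>v n) f = 1\<^sub>m n"
  by (intro eq_matI) (auto simp: transvection_def)

lemma transvection_inverse: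
  fixes x :: "'a::field vec"
  assumes x: "x \<in> carrier_vec n" and f: "f \<in> carrier_vec n" and nz: "1 + f \<bullet> x \<noteq> 0"
  shows "transvection x f * transvection (- (1 / (1 + f \<bullet> x)) \<cdot>\<^sub>v x) f = 1\<^sub>m n"
proof -
  let ?c = "- (1 / (1 + f \<bullet> x))"
  have c: "1 + ?c + ?c * (f \<bullet> x) = 0" using nz by (simp add: field_simps)
  have "x + ?c \<cdot>\<^sub>v x + (f \<bullet> (?c \<cdot>\<^sub>v x)) \<cdot>\<^sub>v x = 0\<^sub>v n"
  proof (rule eq_vecI)
    fix i assume i: "i < dim_vec (0\<^sub>v n :: 'a vec)"
    have "(x + ?c \<cdot>\<^sub>v x + (f \<bullet> (?c \<cdot>\<^sub>v x)) \<cdot>\<^sub>v x) $ i = (1 + ?c + ?c * (f \<bullet> x)) * x $ i"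
      using x f i by (simp add: algebra_simps)
    then show "(x + ?c \<cdot>\<^sub>v x + (f \<bullet> (?c \<cdot>\<^sub>v x)) \<cdot>\<^sub>v x) $ i = 0\<^sub>v n $ i"
      unfolding c using i by simp
  qed (use x in auto)
  then show ?thesis using x f by (simp add: transvection_mult[of _ n] transvection_zero)
qed

lemma transvection_inverse_orthogonal:
  fixes x :: "'a::field vec"
  assumes "x \<in> carrier_vec n" "f \<in> carrier_vec n" "f \<bullet> x = 0"
  shows "transvection x f * transvection (- x) f = 1\<^sub>m n"
proof -
  have "- (1::'a) \<cdot>\<^sub>v x = - x" by (intro eq_vecI) auto
  then show ?thesis using transvection_inverse[OF assms(1,2)] assms(3) by simp
qed

lemma mult_mat_vec_transpose_inverse:
  fixes P :: "'a::field mat"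
  assumes P: "P \<in> carrier_mat n n" "P' \<in> carrier_mat n n" "P * P' = 1\<^sub>m n"
    and f: "f \<in> carrier_vec n"
  shows "P'\<^sup>T *\<^sub>v (P\<^sup>T *\<^sub>v f) = f"
proof -
  have "P'\<^sup>T *\<^sub>v (P\<^sup>T *\<^sub>v f) = (P * P')\<^sup>T *\<^sub>v f"
    using P(1,2) f by (simp add: transpose_mult[of P n n P' n] assoc_mult_mat_vec[of _ n n _ n])
  then show ?thesis using P f by simp
qed

text \<open>Vectors move by \<open>P\<close> and covectors by the inverse transpose of
  \<open>P\<close>, so the pairing of covector and vector is invariant.\<close>

lemma transvection_conjugate:
  fixes P :: "'a::field mat"
  assumes P: "P \<in> carrier_mat n n" "P' \<in> carrier_mat n n" "P * P' = 1\<^sub>m n"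
    and x: "x \<in> carrier_vec n" and f: "f \<in> carrier_vec n"
  shows "P * transvection x f * P' = transvection (P *\<^sub>v x) (P'\<^sup>T *\<^sub>v f)"
proof (rule eq_mat_on_vecs[of _ n n])
  fix v :: "'a vec" assume v: "v \<in> carrier_vec n"
  have PP'v: "P *\<^sub>v (P' *\<^sub>v v) = v" using P v by (metis assoc_mult_mat_vec one_mult_mat_vec)
  have T: "transvection x f \<in> carrier_mat n n" using x by simp
  have "(P * transvection x f * P') *\<^sub>v v = P *\<^sub>v (transvection x f *\<^sub>v (P' *\<^sub>v v))"
    using P(1,2) v T by (simp add: assoc_mult_mat_vec[of _ n n _ n] mult_carrier_mat[of _ n n _ n])
  also have "\<dots> = P *\<^sub>v (P' *\<^sub>v v + (f \<bullet> (P' *\<^sub>v v)) \<cdot>\<^sub>v x)"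
    using P x f v by (subst transvection_mult_vec[of _ n]) auto
  also have "\<dots> = v + (f \<bullet> (P' *\<^sub>v v)) \<cdot>\<^sub>v (P *\<^sub>v x)"
    using P x f v PP'v by (simp add: mult_add_distrib_mat_vec[of _ n n] mult_mat_vec[of _ n n])
  also have "f \<bullet> (P' *\<^sub>v v) = (P'\<^sup>T *\<^sub>v f) \<bullet> v"
    using transpose_vec_mult_scalar[OF P(2) v f] by simp
  finally show "(P * transvection x f * P') *\<^sub>v v = transvection (P *\<^sub>v x) (P'\<^sup>T *\<^sub>v f) *\<^sub>v v"
    using P x f v by (subst transvection_mult_vec[of _ n]) auto
qed (use P x f in \<open>simp_all add: mult_carrier_mat[of _ n n _ n]\<close>)

text \<open>A vector space is not the union of two proper subspaces. Concretely, one of two unit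
  vectors avoids both kernels, or else their sum does. The resulting vector later makes a dilation
  invertible.\<close>

lemma ex_common_nonorthogonal:
  fixes f g :: "'a::field vec"
  assumes f: "f \<in> carrier_vec n" "f \<noteq> 0\<^sub>v n" and g: "g \<in> carrier_vec n" "g \<noteq> 0\<^sub>v n"
  shows "\<exists>z \<in> carrier_vec n. f \<bullet> z = 1 \<and> g \<bullet> z \<noteq> 0"
proof -
  have nz: "\<exists>i<n. h $ i \<noteq> 0" if "h \<in> carrier_vec n" "h \<noteq> 0\<^sub>v n" for h :: "'a vec"
    using that by (metis carrier_vecD eq_vecI index_zero_vec)
  obtain i where i: "i < n" "f $ i \<noteq> 0" using nz[OF f] by blast
  obtain j where j: "j < n" "g $ j \<noteq> 0" using nz[OF g] by blast
  have "\<exists>z \<in> carrier_vec n. f \<bullet> z \<noteq> 0 \<and> g \<bullet> z \<noteq> 0"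
  proof (cases "g $ i \<noteq> 0 \<or> f $ j \<noteq> 0")
    case True
    then show ?thesis using i j f g
      by (auto intro: bexI[of _ "unit_vec n i"] bexI[of _ "unit_vec n j"])
  next
    case False
    then show ?thesis using i j f g
      by (intro bexI[of _ "unit_vec n i + unit_vec n j"]) (auto simp: scalar_prod_add_distrib[of _ n])
  qed
  then obtain z where z: "z \<in> carrier_vec n" "f \<bullet> z \<noteq> 0" "g \<bullet> z \<noteq> 0" by blast
  then show ?thesis using f g by (intro bexI[of _ "(1 / (f \<bullet> z)) \<cdot>\<^sub>v z"]) auto
qed

section \<open>Conjugating transvections inside a normal subgroup of \<open>GL n\<close>\<close>

locale normal_matrices =
  fixes n :: nat and N :: "'a::field mat set"
  assumes carrier: "A \<in> N \<Longrightarrow> A \<in> carrier_mat n n"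
    and mult_closed: "A \<in> N \<Longrightarrow> B \<in> N \<Longrightarrow> A * B \<in> N"
    and inverse_closed: "A \<in> N \<Longrightarrow> \<exists>B \<in> N. A * B = 1\<^sub>m n"
    and conjugate_closed: "A \<in> N \<Longrightarrow> P \<in> carrier_mat n n \<Longrightarrow> P' \<in> carrier_mat n n \<Longrightarrow>
          P * P' = 1\<^sub>m n \<Longrightarrow> P * A * P' \<in> N"
begin

text \<open>Bracketed as \<open>A * (T * A' * T')\<close>, this is a member times a conjugate of its
  inverse. \<open>T\<close> may be any invertible matrix, in \<open>N\<close> or not.\<close>

lemma commutator:
  assumes A: "A \<in> N" and T: "T \<in> carrier_mat n n" "T' \<in> carrier_mat n n" "T * T' = 1\<^sub>m n"
    and A': "A' \<in> carrier_mat n n" "A * A' = 1\<^sub>m n"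
  shows "A * T * A' * T' \<in> N"
proof -
  obtain B where B: "B \<in> N" "A * B = 1\<^sub>m n" using inverse_closed A by blast
  have c: "A \<in> carrier_mat n n" "B \<in> carrier_mat n n" using A B carrier by auto
  have "B * A = 1\<^sub>m n" using mat_mult_left_right_inverse c B by blast
  then have "A' = (B * A) * A'" using A' by simp
  also have "\<dots> = B" using c A' by (simp add: assoc_mult_mat[of _ n n _ n _ n])
  finally have "A' = B" .
  then have "T * A' * T' \<in> N" using conjugate_closed B T by simp
  then have "A * (T * A' * T') \<in> N" using mult_closed A by blast
  moreover have "A * (T * A' * T') = A * T * A' * T'"
    using c(1) T A' by (simp add: assoc_mult_mat[of _ n n _ n _ n])
  ultimately show ?thesis by simp
qed

text \<open>Conjugate by a \<open>P\<close> with \<open>P *\<^sub>v x = y\<close>. With \<psi> equal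
  to 1 on \<open>x\<close>, the map I + (y - x) \<psi>^T does this, and it is invertible because 1 +
  \<psi> \<bullet> (y - x) = \<psi> \<bullet> y \<noteq> 0.\<close>

lemma transvection_change_vector:
  assumes T: "transvection x f \<in> N" and x: "x \<in> carrier_vec n" "x \<noteq> 0\<^sub>v n"
    and f: "f \<in> carrier_vec n" "f \<noteq> 0\<^sub>v n" "f \<bullet> x = 0"
    and y: "y \<in> carrier_vec n" "y \<noteq> 0\<^sub>v n"
  shows "\<exists>g \<in> carrier_vec n. g \<noteq> 0\<^sub>v n \<and> g \<bullet> y = 0 \<and> transvection y g \<in> N"
proof -
  obtain \<psi> where \<psi>: "\<psi> \<in> carrier_vec n" "x \<bullet> \<psi> = 1" "y \<bullet> \<psi> \<noteq> 0"
    using ex_common_nonorthogonal[OF x y] by blast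
  have \<psi>': "\<psi> \<bullet> x = 1" "\<psi> \<bullet> y \<noteq> 0" using \<psi> x y comm_scalar_prod by metis+
  define z where "z = y - x"
  have z: "z \<in> carrier_vec n" using x y by (simp add: z_def)
  have "1 + \<psi> \<bullet> z \<noteq> 0" using \<psi> \<psi>' x y by (simp add: z_def scalar_prod_minus_distrib[of _ n])
  define P where "P = transvection z \<psi>"
  define P' where "P' = transvection (- (1 / (1 + \<psi> \<bullet> z)) \<cdot>\<^sub>v z) \<psi>"
  have P: "P \<in> carrier_mat n n" "P' \<in> carrier_mat n n" "P * P' = 1\<^sub>m n"
    using transvection_inverse[OF z \<psi>(1) \<open>1 + \<psi> \<bullet> z \<noteq> 0\<close>] z by (auto simp: P_def P'_def)
  have Px: "P *\<^sub>v x = y" using x y z \<psi> \<psi>' by (auto simp: P_def transvection_mult_vec[of _ n] z_def)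
  let ?g = "P'\<^sup>T *\<^sub>v f"
  have gy: "?g \<bullet> y = f \<bullet> x"
  proof -
    have "P' * P = 1\<^sub>m n" using mat_mult_left_right_inverse P by blast
    then have "P' *\<^sub>v y = x" using P x unfolding Px[symmetric]
      by (metis assoc_mult_mat_vec one_mult_mat_vec)
    then show ?thesis using transpose_vec_mult_scalar[OF P(2) y(1) f(1)] by simp
  qed
  have "?g \<noteq> 0\<^sub>v n"
  proof
    assume g0: "?g = 0\<^sub>v n"
    have "P' * P = 1\<^sub>m n" using mat_mult_left_right_inverse P by blast
    then have "f = P\<^sup>T *\<^sub>v ?g" using mult_mat_vec_transpose_inverse[of P' n P f] P f by simp
    then have "f = 0\<^sub>v n" unfolding g0 using P by (auto intro: eq_vecI)
    then show False using f by simp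
  qed
  moreover have "transvection y ?g \<in> N"
    using conjugate_closed[OF T P] transvection_conjugate[OF P x(1) f(1)] Px by simp
  ultimately show ?thesis using gy P f by (intro bexI[of _ ?g]) auto
qed

text \<open>Dual to changing the vector: \<psi> = g - f kills \<open>x\<close>, so I + z \<psi>^T
  fixes \<open>x\<close>, while its transpose sends \<open>f\<close> to \<open>g\<close> because f
  \<bullet> z = 1. It is invertible because 1 + \<psi> \<bullet> z = g \<bullet> z \<noteq>
  0.\<close>

lemma transvection_change_covector:
  assumes T: "transvection x f \<in> N" and x: "x \<in> carrier_vec n"
    and f: "f \<in> carrier_vec n" "f \<noteq> 0\<^sub>v n" "f \<bullet> x = 0"
    and g: "g \<in> carrier_vec n" "g \<noteq> 0\<^sub>v n" "g \<bullet> x = 0"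
  shows "transvection x g \<in> N"
proof -
  obtain z where z: "z \<in> carrier_vec n" "f \<bullet> z = 1" "g \<bullet> z \<noteq> 0"
    using ex_common_nonorthogonal[OF f(1,2) g(1,2)] by blast
  define \<psi> where "\<psi> = g - f"
  have \<psi>: "\<psi> \<in> carrier_vec n" using f g by (simp add: \<psi>_def)
  have "1 + \<psi> \<bullet> z \<noteq> 0" using f g z by (simp add: \<psi>_def minus_scalar_prod_distrib[of _ n])
  define P where "P = transvection z \<psi>"
  define P' where "P' = transvection (- (1 / (1 + \<psi> \<bullet> z)) \<cdot>\<^sub>v z) \<psi>"
  have P: "P \<in> carrier_mat n n" "P' \<in> carrier_mat n n" "P * P' = 1\<^sub>m n"
    using transvection_inverse[OF z(1) \<psi>(1) \<open>1 + \<psi> \<bullet> z \<noteq> 0\<close>] z by (auto simp: P_def P'_def)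
  have P'P: "P' * P = 1\<^sub>m n" using mat_mult_left_right_inverse P by blast
  have \<psi>x: "\<psi> \<bullet> x = 0" using f g x by (simp add: \<psi>_def minus_scalar_prod_distrib[of _ n])
  have "P' *\<^sub>v x = x" using x z \<psi> \<psi>x by (auto simp: P'_def transvection_mult_vec[of _ n])
  moreover have "P\<^sup>T *\<^sub>v f = g"
  proof -
    have "z \<bullet> f = 1" using z f comm_scalar_prod by metis
    then show ?thesis using z \<psi> f g
      by (auto simp: P_def transvection_transpose[of _ n] transvection_mult_vec[of _ n] \<psi>_def)
  qed
  ultimately show ?thesis
    using conjugate_closed[OF T P(2,1) P'P] transvection_conjugate[OF P(2,1) P'P x f(1)] by simp
qed

lemma transvection_transitive:
  assumes T: "transvection x f \<in> N" and x: "x \<in> carrier_vec n" "x \<noteq> 0\<^sub>v n"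
    and f: "f \<in> carrier_vec n" "f \<noteq> 0\<^sub>v n" "f \<bullet> x = 0"
    and y: "y \<in> carrier_vec n" "y \<noteq> 0\<^sub>v n"
    and g: "g \<in> carrier_vec n" "g \<noteq> 0\<^sub>v n" "g \<bullet> y = 0"
  shows "transvection y g \<in> N"
  using transvection_change_vector[OF T x f y] transvection_change_covector[OF _ y(1) _ _ _ g]
  by blast

end

section \<open>Transvections in normal subgroups\<close>

text \<open>Two linear conditions on at least three unknowns. The square matrix with rows
  \<open>u\<close>, \<open>v\<close> and zeros has a zero row at index 2, hence determinant 0 and a
  nonzero kernel vector.\<close>

lemma ex_orthogonal_pair:
  fixes u v :: "'a::field vec"
  assumes "n \<ge> 3" and u: "u \<in> carrier_vec n" and v: "v \<in> carrier_vec n"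
  shows "\<exists>f \<in> carrier_vec n. f \<noteq> 0\<^sub>v n \<and> f \<bullet> u = 0 \<and> f \<bullet> v = 0"
proof -
  define A where "A = mat n n (\<lambda>(i, j). if i = 0 then u $ j else if i = 1 then v $ j else 0)"
  have A: "A \<in> carrier_mat n n" by (simp add: A_def)
  have "A\<^sup>T *\<^sub>v unit_vec n 2 = 0\<^sub>v n" using assms(1) by (intro eq_vecI) (auto simp: A_def)
  moreover have "unit_vec n 2 \<noteq> (0\<^sub>v n :: 'a vec)" using assms(1) by simp
  ultimately have "det (A\<^sup>T) = 0"
    using det_0_iff_vec_prod_zero_field[of "A\<^sup>T" n] A by (auto intro: exI[of _ "unit_vec n 2"])
  then have "det A = 0" using det_transpose[OF A] by simp
  then obtain f where f: "f \<in> carrier_vec n" "f \<noteq> 0\<^sub>v n" "A *\<^sub>v f = 0\<^sub>v n"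
    using det_0_iff_vec_prod_zero_field[OF A] by blast
  have "(A *\<^sub>v f) $ 0 = u \<bullet> f" "(A *\<^sub>v f) $ 1 = v \<bullet> f"
    using assms f(1) by (auto simp: A_def scalar_prod_def)
  then have "u \<bullet> f = 0" "v \<bullet> f = 0" using f(3) assms(1) by auto
  then show ?thesis using f u v comm_scalar_prod by metis
qed

lemma ex_dual_pair_2:
  fixes u v :: "'a::field vec"
  assumes u: "u \<in> carrier_vec 2" and v: "v \<in> carrier_vec 2" and indep: "\<And>c. v \<noteq> c \<cdot>\<^sub>v u" "u \<noteq> 0\<^sub>v 2"
  shows "\<exists>f \<in> carrier_vec 2. f \<bullet> u = 1 \<and> f \<bullet> v = 0"
proof -
  \<comment> \<open>\<open>D\<close> is the determinant of the matrix with columns \<open>u\<close>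
    and \<open>v\<close>, nonzero by independence.\<close>
  define D where "D = v $ 1 * u $ 0 - v $ 0 * u $ 1"
  have D: "D \<noteq> 0"
  proof
    assume D0: "D = 0"
    have "u $ 0 \<noteq> 0 \<or> u $ 1 \<noteq> 0"
    proof (rule ccontr)
      assume "\<not> ?thesis"
      then have "u = 0\<^sub>v 2" using u by (intro eq_vecI) (auto simp: less_2_cases_iff)
      with indep(2) show False ..
    qed
    then show False
    proof
      assume "u $ 0 \<noteq> 0"
      then have "v = (v $ 0 / u $ 0) \<cdot>\<^sub>v u"
        using u v D0 by (intro eq_vecI) (auto simp: less_2_cases_iff D_def field_simps)
      with indep(1) show False by blast
    next
      assume "u $ 1 \<noteq> 0"
      then have "v = (v $ 1 / u $ 1) \<cdot>\<^sub>v u"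
        using u v D0 by (intro eq_vecI) (auto simp: less_2_cases_iff D_def field_simps)
      with indep(1) show False by blast
    qed
  qed
  \<comment> \<open>The first row of the inverse of that matrix, by Cramer's rule.\<close>
  define f where "f = vec 2 (\<lambda>i. if i = 0 then v $ 1 / D else - v $ 0 / D)"
  have "f \<bullet> w = (v $ 1 * w $ 0 - v $ 0 * w $ 1) / D" if "w \<in> carrier_vec 2" for w
    using that by (simp add: f_def scalar_prod_def numeral_2_eq_2 diff_divide_distrib)
  then show ?thesis using u v D by (intro bexI[of _ f]) (auto simp: D_def f_def)
qed

text \<open>If every vector were an eigenvector, the unit vectors would make \<open>g\<close>
  diagonal and the all-ones vector would make its diagonal constant.\<close>

lemma nonscalar_moves_vec:
  fixes g :: "'a::field mat"
  assumes g: "g \<in> carrier_mat n n" and nonscalar: "\<And>a. g \<noteq> a \<cdot>\<^sub>m 1\<^sub>m n"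
  shows "\<exists>u \<in> carrier_vec n. \<forall>c. g *\<^sub>v u \<noteq> c \<cdot>\<^sub>v u"
proof (rule ccontr)
  assume "\<not> ?thesis"
  then have eig: "\<exists>c. g *\<^sub>v u = c \<cdot>\<^sub>v u" if "u \<in> carrier_vec n" for u using that by blast
  have off: "g $$ (i, j) = 0" if ij: "i < n" "j < n" "i \<noteq> j" for i j
  proof -
    obtain c where "g *\<^sub>v unit_vec n j = c \<cdot>\<^sub>v unit_vec n j" using eig[of "unit_vec n j"] by auto
    then have "(g *\<^sub>v unit_vec n j) $ i = (c \<cdot>\<^sub>v unit_vec n j) $ i" by simp
    then show ?thesis using ij g by simp
  qed
  obtain c where c: "g *\<^sub>v vec n (\<lambda>_. 1) = c \<cdot>\<^sub>v vec n (\<lambda>_. 1)" using eig[of "vec n (\<lambda>_. 1)"] by auto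
  have "g $$ (i, i) = c" if i: "i < n" for i
  proof -
    have "c = (g *\<^sub>v vec n (\<lambda>_. 1)) $ i" unfolding c using i by simp
    also have "\<dots> = (\<Sum>j<n. g $$ (i, j))"
      using g i by (simp add: scalar_prod_def lessThan_atLeast0)
    also have "\<dots> = (\<Sum>j<n. if j = i then g $$ (i, i) else 0)"
      using off i by (intro sum.cong) auto
    also have "\<dots> = g $$ (i, i)" using i by simp
    finally show ?thesis by simp
  qed
  then have "g = c \<cdot>\<^sub>m 1\<^sub>m n" using g off by (intro eq_matI) auto
  with nonscalar show False by blast
qed

section \<open>Existence of a transvection in a nonscalar normal subgroup\<close>

context normal_matrices begin

lemma inverseE:
  assumes "A \<in> N"
  obtains B where "B \<in> carrier_mat n n" "A * B = 1\<^sub>m n" "B * A = 1\<^sub>m n"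
  using assms inverse_closed carrier mat_mult_left_right_inverse by metis

text \<open>With \<open>h = [g, I + u f\<^sup>T]\<close>, a covector \<open>\<phi>\<close> killing \<open>u\<close> and \<open>g u\<close> is fixed by \<open>h\<close>. Hence either
  \<open>[h, I + w \<phi>\<^sup>T] = I + (h w - w) \<phi>\<^sup>T\<close> is nontrivial for some \<open>w\<close> in the kernel of \<open>\<phi>\<close>, or \<open>h\<close> is itself
  of the form \<open>I + x \<phi>\<^sup>T\<close>.\<close>

lemma ex_transvection_ge_3:
  assumes n: "n \<ge> 3" and g: "g \<in> N" and u: "u \<in> carrier_vec n" and gu: "\<And>c. g *\<^sub>v u \<noteq> c \<cdot>\<^sub>v u"
  shows "\<exists>x \<in> carrier_vec n. \<exists>f \<in> carrier_vec n. x \<noteq> 0\<^sub>v n \<and> f \<noteq> 0\<^sub>v n \<and> f \<bullet> x = 0 \<and> transvection x f \<in> N"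
proof -
  have gc: "g \<in> carrier_mat n n" using g carrier by blast
  obtain g' where g': "g' \<in> carrier_mat n n" "g * g' = 1\<^sub>m n" "g' * g = 1\<^sub>m n" using inverseE[OF g] .
  obtain f where f: "f \<in> carrier_vec n" "f \<noteq> 0\<^sub>v n" "f \<bullet> u = 0" using ex_orthogonal_pair[OF n u u] by blast
  define v where "v = g *\<^sub>v u"
  have v: "v \<in> carrier_vec n" using gc u by (simp add: v_def)
  obtain \<phi> where \<phi>: "\<phi> \<in> carrier_vec n" "\<phi> \<noteq> 0\<^sub>v n" "\<phi> \<bullet> u = 0" "\<phi> \<bullet> v = 0"
    using ex_orthogonal_pair[OF n u v] by blast
  define T where "T = transvection u f"
  define T' where "T' = transvection (- u) f"
  have T: "T \<in> carrier_mat n n" "T' \<in> carrier_mat n n" "T * T' = 1\<^sub>m n"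
    using transvection_inverse_orthogonal[OF u f(1,3)] u by (auto simp: T_def T'_def)
  have T'T: "T' * T = 1\<^sub>m n" using mat_mult_left_right_inverse T by blast
  define h where "h = g * T * g' * T'"
  have h: "h \<in> N" unfolding h_def by (rule commutator[OF g T g'(1,2)])
  have hc: "h \<in> carrier_mat n n" using h carrier by blast
  define \<psi> where "\<psi> = g'\<^sup>T *\<^sub>v f"
  have \<psi>: "\<psi> \<in> carrier_vec n" using g' f by (simp add: \<psi>_def)
  have gTg': "g * T * g' = transvection v \<psi>"
    unfolding T_def v_def \<psi>_def by (rule transvection_conjugate[OF gc g'(1,2) u f(1)])
  \<comment> \<open>If \<open>h\<close> were the identity, the rank-one parts v \<psi>^T and u f^T
    would agree. Then \<open>v\<close> would be a multiple of \<open>u\<close>, or \<open>u\<close>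
    would vanish; both contradict \<open>gu\<close>.\<close>
  have h_ne: "h \<noteq> 1\<^sub>m n"
  proof
    assume "h = 1\<^sub>m n"
    then have "h * T = T" using T by simp
    moreover have "h * T = transvection v \<psi>"
      unfolding h_def gTg' using T T'T v
      by (simp add: assoc_mult_mat[of _ n n _ n _ n] right_mult_one_mat[of _ n n])
    ultimately have eq: "transvection v \<psi> = transvection u f" by (simp add: T_def)
    obtain j where j: "j < n" "f $ j \<noteq> 0" using f by (metis carrier_vecD eq_vecI index_zero_vec)
    have ent: "v $ i * \<psi> $ j = u $ i * f $ j" if i: "i < n" for i
    proof -
      have "transvection v \<psi> $$ (i, j) = transvection u f $$ (i, j)" using eq by simp
      then show ?thesis using i j u v by (simp add: transvection_def)
    qed
    show False
    proof (cases "\<psi> $ j = 0")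
      case True
      then have "u = 0\<^sub>v n" using ent j u by (intro eq_vecI) auto
      then have "g *\<^sub>v u = 0 \<cdot>\<^sub>v u" using gc by (intro eq_vecI) auto
      with gu show False by blast
    next
      case False
      then have "v = (f $ j / \<psi> $ j) \<cdot>\<^sub>v u" using ent u v by (intro eq_vecI) (auto simp: field_simps)
      with gu show False unfolding v_def by blast
    qed
  qed
  obtain h' where h': "h' \<in> carrier_mat n n" "h * h' = 1\<^sub>m n" "h' * h = 1\<^sub>m n" using inverseE[OF h] .
  \<comment> \<open>The two factors of the transpose add multiples of \<psi> and \<open>f\<close>,
    with coefficients given by the pairings of \<phi> with \<open>v\<close> and \<open>u\<close>,
    which are zero.\<close>
  have h\<phi>: "h\<^sup>T *\<^sub>v \<phi> = \<phi>"
  proof -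
    have "h\<^sup>T *\<^sub>v \<phi> = transvection f (- u) *\<^sub>v (transvection \<psi> v *\<^sub>v \<phi>)"
      unfolding h_def gTg' T'_def using u f(1) v \<psi> \<phi>(1)
      by (simp add: transpose_mult[of _ n n _ n] transvection_transpose[of _ n]
          assoc_mult_mat_vec[of _ n n _ n])
    moreover have "v \<bullet> \<phi> = 0" "u \<bullet> \<phi> = 0" using \<phi> u v comm_scalar_prod by metis+
    moreover have "transvection \<psi> v *\<^sub>v \<phi> = \<phi>" "transvection f (- u) *\<^sub>v \<phi> = \<phi>"
      using calculation(2,3) u v \<psi> \<phi>(1) f(1)
      by (auto simp: transvection_mult_vec[of _ n] intro!: eq_vecI)
    ultimately show ?thesis by simp
  qed
  have h'\<phi>: "h'\<^sup>T *\<^sub>v \<phi> = \<phi>"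
    using mult_mat_vec_transpose_inverse[OF hc h'(1,2) \<phi>(1)] h\<phi> by simp
  \<comment> \<open>This supplies the orthogonality that makes the later I + x \<phi>^T genuine
    transvections.\<close>
  have \<phi>h: "\<phi> \<bullet> (h *\<^sub>v w - w) = 0" if w: "w \<in> carrier_vec n" for w
    using transpose_vec_mult_scalar[OF hc w \<phi>(1)] h\<phi> hc w \<phi>(1)
    by (simp add: scalar_prod_minus_distrib[of _ n])
  show ?thesis
  proof (cases "\<exists>w \<in> carrier_vec n. \<phi> \<bullet> w = 0 \<and> h *\<^sub>v w \<noteq> w")
    case True
    then obtain w where w: "w \<in> carrier_vec n" "\<phi> \<bullet> w = 0" "h *\<^sub>v w \<noteq> w" by blast
    have "h * transvection w \<phi> * h' * transvection (- w) \<phi> \<in> N"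
      using transvection_inverse_orthogonal[OF w(1) \<phi>(1) w(2)] w(1) h'
      by (intro commutator[OF h]) auto
    moreover have "h * transvection w \<phi> * h' * transvection (- w) \<phi> = transvection (h *\<^sub>v w - w) \<phi>"
    proof -
      have "h *\<^sub>v w + - w + (\<phi> \<bullet> (- w)) \<cdot>\<^sub>v (h *\<^sub>v w) = h *\<^sub>v w - w"
        using w hc \<phi>(1) by (intro eq_vecI) auto
      then show ?thesis
        using transvection_conjugate[OF hc h'(1,2) w(1) \<phi>(1)] h'\<phi>
          transvection_mult[of "h *\<^sub>v w" n "- w" \<phi>] hc w \<phi>(1) by simp
    qed
    moreover have "h *\<^sub>v w - w \<noteq> 0\<^sub>v n"
    proof
      assume "h *\<^sub>v w - w = 0\<^sub>v n"
      then have "h *\<^sub>v w = w" using hc w by (auto simp: vec_eq_iff)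
      with w show False by simp
    qed
    ultimately show ?thesis using w hc \<phi> \<phi>h
      by (intro bexI[of _ "h *\<^sub>v w - w"] bexI[of _ \<phi>]) auto
  next
    case False
    \<comment> \<open>\<open>h\<close> is the identity on the kernel of \<phi>, and \<open>z\<close>
      spans a complement of that kernel. So \<open>h\<close> is determined by its effect on
      \<open>z\<close>.\<close>
    obtain z where z: "z \<in> carrier_vec n" "\<phi> \<bullet> z = 1"
      using ex_common_nonorthogonal[OF \<phi>(1,2) \<phi>(1,2)] by blast
    define x where "x = h *\<^sub>v z - z"
    have x: "x \<in> carrier_vec n" using hc z by (simp add: x_def)
    have hx: "h = transvection x \<phi>"
    proof (rule eq_mat_on_vecs[of _ n n])
      fix y :: "'a vec" assume y: "y \<in> carrier_vec n"
      define c where "c = \<phi> \<bullet> y"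
      define w where "w = y - c \<cdot>\<^sub>v z"
      have w: "w \<in> carrier_vec n" using y z by (simp add: w_def)
      have "\<phi> \<bullet> w = 0" using y z \<phi>(1) by (simp add: w_def c_def scalar_prod_minus_distrib[of _ n])
      then have hw: "h *\<^sub>v w = w" using False w by blast
      have "y = w + c \<cdot>\<^sub>v z" using y z by (intro eq_vecI) (auto simp: w_def)
      then have "h *\<^sub>v y = w + c \<cdot>\<^sub>v (h *\<^sub>v z)"
        using hw hc w z by (simp add: mult_add_distrib_mat_vec[of _ n n] mult_mat_vec[of _ n n])
      also have "\<dots> = y + c \<cdot>\<^sub>v x" using y z hc by (intro eq_vecI) (auto simp: w_def x_def algebra_simps)
      finally show "h *\<^sub>v y = transvection x \<phi> *\<^sub>v y"
        using x y \<phi>(1) by (simp add: transvection_mult_vec[of _ n] c_def)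
    qed (use hc x in auto)
    have "x \<noteq> 0\<^sub>v n" using h_ne hx transvection_zero by metis
    moreover have "\<phi> \<bullet> x = 0" unfolding x_def by (rule \<phi>h[OF z(1)])
    ultimately show ?thesis using h x \<phi> hx by metis
  qed
qed

text \<open>Choose \<open>f\<close> with \<open>f \<bullet> u = 1\<close> and \<open>f \<bullet> v = 0\<close>, where \<open>v = g u\<close>. For \<open>h = [g, I + (r - 1) u f\<^sup>T]\<close> one gets
  \<open>h v = r v\<close> and \<open>f h = r\<^sup>-\<^sup>1 f\<close>, so that \<open>[h, I + v f\<^sup>T] = I + (r\<^sup>2 - 1) v f\<^sup>T\<close>.\<close>

lemma ex_transvection_2:
  assumes n: "n = 2" and g: "g \<in> N" and u: "u \<in> carrier_vec n" and gu: "\<And>c. g *\<^sub>v u \<noteq> c \<cdot>\<^sub>v u"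
    and r: "(r::'a) \<noteq> 0" "r\<^sup>2 \<noteq> 1"
  shows "\<exists>x \<in> carrier_vec n. \<exists>f \<in> carrier_vec n. x \<noteq> 0\<^sub>v n \<and> f \<noteq> 0\<^sub>v n \<and> f \<bullet> x = 0 \<and> transvection x f \<in> N"
proof -
  have gc: "g \<in> carrier_mat n n" using g carrier by blast
  obtain g' where g': "g' \<in> carrier_mat n n" "g * g' = 1\<^sub>m n" "g' * g = 1\<^sub>m n" using inverseE[OF g] .
  define v where "v = g *\<^sub>v u"
  have v: "v \<in> carrier_vec n" using gc u by (simp add: v_def)
  have "u \<noteq> 0\<^sub>v n"
  proof
    assume "u = 0\<^sub>v n"
    then have "g *\<^sub>v u = 0 \<cdot>\<^sub>v u" using gc by (intro eq_vecI) auto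
    with gu show False by blast
  qed
  then obtain f where f: "f \<in> carrier_vec n" "f \<bullet> u = 1" "f \<bullet> v = 0"
    using ex_dual_pair_2[of u v] u v gu unfolding v_def n by blast
  have f0: "f \<noteq> 0\<^sub>v n" using f u by auto
  have uf: "u \<bullet> f = 1" "v \<bullet> f = 0" using f u v comm_scalar_prod by metis+
  have g'v: "g' *\<^sub>v v = u"
    using g' gc u unfolding v_def by (metis assoc_mult_mat_vec one_mult_mat_vec)
  \<comment> \<open>A dilation with eigenvalue r on \<open>u\<close>, hence of determinant r, and
    its inverse. It lies outside \<open>SL n\<close> unless r = 1, which is allowed since
    \<open>N\<close> is normal in \<open>GL n\<close>.\<close>
  define T where "T = transvection ((r - 1) \<cdot>\<^sub>v u) f"
  define T' where "T' = transvection ((1 / r - 1) \<cdot>\<^sub>v u) f"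
  have T: "T \<in> carrier_mat n n" "T' \<in> carrier_mat n n" using u by (auto simp: T_def T'_def)
  have TT': "T * T' = 1\<^sub>m n"
  proof -
    have "(r - 1) \<cdot>\<^sub>v u + (1 / r - 1) \<cdot>\<^sub>v u + (f \<bullet> ((1 / r - 1) \<cdot>\<^sub>v u)) \<cdot>\<^sub>v ((r - 1) \<cdot>\<^sub>v u) = 0\<^sub>v n"
      using u f r by (intro eq_vecI) (auto simp: field_simps)
    then show ?thesis
      using transvection_mult[of "(r - 1) \<cdot>\<^sub>v u" n "(1 / r - 1) \<cdot>\<^sub>v u" f] u f
      by (simp add: T_def T'_def transvection_zero)
  qed
  define h where "h = g * T * g' * T'"
  have h: "h \<in> N" unfolding h_def by (rule commutator[OF g T TT' g'(1,2)])
  have hc: "h \<in> carrier_mat n n" using h carrier by blast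
  obtain h' where h': "h' \<in> carrier_mat n n" "h * h' = 1\<^sub>m n" "h' * h = 1\<^sub>m n" using inverseE[OF h] .
  define \<psi> where "\<psi> = g'\<^sup>T *\<^sub>v f"
  have \<psi>: "\<psi> \<in> carrier_vec n" using g' f by (simp add: \<psi>_def)
  have \<psi>v: "\<psi> \<bullet> v = 1" using transpose_vec_mult_scalar[OF g'(1) v f(1)] g'v f by (simp add: \<psi>_def)
  define v' where "v' = (r - 1) \<cdot>\<^sub>v v"
  have v': "v' \<in> carrier_vec n" using v by (simp add: v'_def)
  have gTg': "g * T * g' = transvection v' \<psi>"
    using transvection_conjugate[OF gc g'(1,2) _ f(1), of "(r - 1) \<cdot>\<^sub>v u"] u gc
    by (simp add: T_def v'_def v_def \<psi>_def mult_mat_vec[of _ n n])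
  have hv: "h *\<^sub>v v = r \<cdot>\<^sub>v v"
  proof -
    have "h *\<^sub>v v = transvection v' \<psi> *\<^sub>v (T' *\<^sub>v v)"
      unfolding h_def gTg' using T v v' by (simp add: assoc_mult_mat_vec[of _ n n _ n])
    also have "T' *\<^sub>v v = v" using u f v by (auto simp: T'_def transvection_mult_vec[of _ n])
    also have "transvection v' \<psi> *\<^sub>v v = r \<cdot>\<^sub>v v"
      using v v' \<psi> \<psi>v by (auto simp: transvection_mult_vec[of _ n] v'_def algebra_simps intro!: eq_vecI)
    finally show ?thesis .
  qed
  have "h\<^sup>T *\<^sub>v f = (1 / r) \<cdot>\<^sub>v f"
  proof -
    have "h\<^sup>T *\<^sub>v f = transvection f ((1 / r - 1) \<cdot>\<^sub>v u) *\<^sub>v (transvection \<psi> v' *\<^sub>v f)"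
      unfolding h_def gTg' T'_def using u f(1) v' \<psi>
      by (simp add: transpose_mult[of _ n n _ n] transvection_transpose[of _ n]
          assoc_mult_mat_vec[of _ n n _ n])
    also have "transvection \<psi> v' *\<^sub>v f = f"
      using \<psi> v' v f uf by (auto simp: transvection_mult_vec[of _ n] v'_def)
    also have "transvection f ((1 / r - 1) \<cdot>\<^sub>v u) *\<^sub>v f = (1 / r) \<cdot>\<^sub>v f"
      using u f uf by (auto simp: transvection_mult_vec[of _ n] algebra_simps intro!: eq_vecI)
    finally show ?thesis .
  qed
  then have "h'\<^sup>T *\<^sub>v ((1 / r) \<cdot>\<^sub>v f) = f"
    using mult_mat_vec_transpose_inverse[OF hc h'(1,2) f(1)] by simp
  then have h'f: "h'\<^sup>T *\<^sub>v f = r \<cdot>\<^sub>v f"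
    using h' f r by (metis mult_mat_vec nonzero_divide_eq_eq one_smult_vec smult_smult_assoc transpose_carrier_mat mult.commute smult_carrier_vec)
  have "h * transvection v f * h' * transvection (- v) f \<in> N"
    using transvection_inverse_orthogonal[OF v f(1,3)] v h' by (intro commutator[OF h]) auto
  moreover have "h * transvection v f * h' = transvection (r\<^sup>2 \<cdot>\<^sub>v v) f"
    unfolding transvection_conjugate[OF hc h'(1,2) v f(1)] hv h'f
    using v f by (intro eq_matI) (auto simp: transvection_def power2_eq_square)
  moreover have "transvection (r\<^sup>2 \<cdot>\<^sub>v v) f * transvection (- v) f = transvection ((r\<^sup>2 - 1) \<cdot>\<^sub>v v) f"
  proof -
    have "r\<^sup>2 \<cdot>\<^sub>v v + - v + (f \<bullet> (- v)) \<cdot>\<^sub>v (r\<^sup>2 \<cdot>\<^sub>v v) = (r\<^sup>2 - 1) \<cdot>\<^sub>v v"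
      using v f by (intro eq_vecI) (auto simp: algebra_simps)
    then show ?thesis using transvection_mult[of "r\<^sup>2 \<cdot>\<^sub>v v" n "- v" f] v f by simp
  qed
  moreover have "(r\<^sup>2 - 1) \<cdot>\<^sub>v v \<noteq> 0\<^sub>v n"
  proof
    assume e: "(r\<^sup>2 - 1) \<cdot>\<^sub>v v = 0\<^sub>v n"
    have "v = 0 \<cdot>\<^sub>v u"
    proof (rule eq_vecI)
      fix i assume i: "i < dim_vec (0 \<cdot>\<^sub>v u)"
      have "((r\<^sup>2 - 1) \<cdot>\<^sub>v v) $ i = 0\<^sub>v n $ i" using e by simp
      then show "v $ i = (0 \<cdot>\<^sub>v u) $ i" using i u v r by simp
    qed (use u v in auto)
    with gu show False unfolding v_def by blast
  qed
  ultimately show ?thesis using v f f0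
    by (intro bexI[of _ "(r\<^sup>2 - 1) \<cdot>\<^sub>v v"] bexI[of _ f]) auto
qed

lemma transvection_mem:
  assumes g: "g \<in> N" "\<And>a. g \<noteq> a \<cdot>\<^sub>m 1\<^sub>m n"
    and n: "n \<ge> 3 \<or> n = 2 \<and> (\<exists>r::'a. r \<noteq> 0 \<and> r\<^sup>2 \<noteq> 1)"
    and x: "x \<in> carrier_vec n" and f: "f \<in> carrier_vec n" "f \<bullet> x = 0"
  shows "transvection x f \<in> N"
proof -
  obtain u where u: "u \<in> carrier_vec n" "\<And>c. g *\<^sub>v u \<noteq> c \<cdot>\<^sub>v u"
    using nonscalar_moves_vec[OF carrier[OF g(1)] g(2)] by blast
  have "\<exists>x \<in> carrier_vec n. \<exists>f \<in> carrier_vec n. x \<noteq> 0\<^sub>v n \<and> f \<noteq> 0\<^sub>v n \<and> f \<bullet> x = 0 \<and> transvection x f \<in> N"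
    using n
  proof
    assume "n = 2 \<and> (\<exists>r::'a. r \<noteq> 0 \<and> r\<^sup>2 \<noteq> 1)"
    then show ?thesis using ex_transvection_2[OF _ g(1) u] by blast
  qed (rule ex_transvection_ge_3[OF _ g(1) u])
  then obtain y h where y: "y \<in> carrier_vec n" "y \<noteq> 0\<^sub>v n"
    and h: "h \<in> carrier_vec n" "h \<noteq> 0\<^sub>v n" "h \<bullet> y = 0" and T: "transvection y h \<in> N" by blast
  show ?thesis
  proof (cases "x = 0\<^sub>v n \<or> f = 0\<^sub>v n")
    case True
    then have "transvection x f = 1\<^sub>m n"
      using x f by (intro eq_matI) (auto simp: transvection_def)
    moreover have "1\<^sub>m n \<in> N" using inverse_closed[OF g(1)] g(1) mult_closed by metis
    ultimately show ?thesis by simp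
  next
    case False
    then show ?thesis using transvection_transitive[OF T y h x _ f(1) _ f(2)] by blast
  qed
qed

end

section \<open>Row and column operations\<close>

text \<open>Multiples of line \<open>c\<close> are added to all lines at once, so that a single
  operation clears a pivot column or adjusts a whole diagonal.\<close>

definition row_shear :: "nat \<Rightarrow> (nat \<Rightarrow> 'a) \<Rightarrow> 'a::field mat \<Rightarrow> 'a mat" where
  "row_shear c w X = mat (dim_row X) (dim_col X) (\<lambda>(i, j). X $$ (i, j) + w i * X $$ (c, j))"

definition col_shear :: "nat \<Rightarrow> (nat \<Rightarrow> 'a) \<Rightarrow> 'a::field mat \<Rightarrow> 'a mat" where
  "col_shear c w X = mat (dim_row X) (dim_col X) (\<lambda>(i, j). X $$ (i, j) + X $$ (i, c) * w j)"

lemma row_shear_carrier [simp]: "row_shear c w X \<in> carrier_mat n m \<longleftrightarrow> X \<in> carrier_mat n m"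
  and col_shear_carrier [simp]: "col_shear c w X \<in> carrier_mat n m \<longleftrightarrow> X \<in> carrier_mat n m"
  unfolding row_shear_def col_shear_def carrier_mat_def by simp_all

lemma row_shear_index:
  "X \<in> carrier_mat n m \<Longrightarrow> i < n \<Longrightarrow> j < m \<Longrightarrow>
    row_shear c w X $$ (i, j) = X $$ (i, j) + w i * X $$ (c, j)"
  and col_shear_index:
  "X \<in> carrier_mat n m \<Longrightarrow> i < n \<Longrightarrow> j < m \<Longrightarrow>
    col_shear c w X $$ (i, j) = X $$ (i, j) + X $$ (i, c) * w j"
  by (auto simp: row_shear_def col_shear_def)

locale shear_closed =
  fixes n :: nat and S :: "'a::field mat set"
  assumes row_shear_closed:
      "X \<in> S \<Longrightarrow> X \<in> carrier_mat n n \<Longrightarrow> c < n \<Longrightarrow> w c = 0 \<Longrightarrow> row_shear c w X \<in> S"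
    and col_shear_closed:
      "X \<in> S \<Longrightarrow> X \<in> carrier_mat n n \<Longrightarrow> c < n \<Longrightarrow> w c = 0 \<Longrightarrow> col_shear c w X \<in> S"
begin

text \<open>Since \<open>w c = 0\<close> leaves row \<open>c\<close> unchanged, the shear by the
  negated weights is the inverse. Membership can thus be carried back from a reduced matrix to the
  original.\<close>

lemma row_shear_iff:
  assumes X: "X \<in> carrier_mat n n" and "c < n" "w c = 0"
  shows "row_shear c w X \<in> S \<longleftrightarrow> X \<in> S"
proof
  assume "row_shear c w X \<in> S"
  then have "row_shear c (\<lambda>i. - w i) (row_shear c w X) \<in> S"
    using assms by (intro row_shear_closed[of "row_shear c w X" c]) simp_all
  moreover have "row_shear c (\<lambda>i. - w i) (row_shear c w X) = X"
    using assms by (intro eq_matI) (auto simp: row_shear_def)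
  ultimately show "X \<in> S" by simp
qed (use assms in \<open>simp add: row_shear_closed\<close>)

lemma col_shear_iff:
  assumes X: "X \<in> carrier_mat n n" and "c < n" "w c = 0"
  shows "col_shear c w X \<in> S \<longleftrightarrow> X \<in> S"
proof
  assume "col_shear c w X \<in> S"
  then have "col_shear c (\<lambda>i. - w i) (col_shear c w X) \<in> S"
    using assms by (intro col_shear_closed[of "col_shear c w X" c]) simp_all
  moreover have "col_shear c (\<lambda>i. - w i) (col_shear c w X) = X"
    using assms by (intro eq_matI) (auto simp: col_shear_def)
  ultimately show "X \<in> S" by simp
qed (use assms in \<open>simp add: col_shear_closed\<close>)

end

text \<open>The block shape diag(I, Y) with an identity block of size \<open>m\<close> and
  \<open>Y\<close> arbitrary; for \<open>m = 0\<close> only the dimensions are constrained.\<close>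

definition starts_with_identity :: "nat \<Rightarrow> nat \<Rightarrow> 'a::field mat \<Rightarrow> bool" where
  "starts_with_identity n m X \<longleftrightarrow> X \<in> carrier_mat n n \<and>
     (\<forall>i<n. \<forall>j<n. i < m \<or> j < m \<longrightarrow> X $$ (i, j) = (if i = j then 1 else 0))"

lemma starts_with_identity_row_shear:
  assumes "starts_with_identity n m X" "m \<le> c" "c < n" "\<And>i. i < m \<Longrightarrow> w i = 0"
  shows "starts_with_identity n m (row_shear c w X)"
  unfolding starts_with_identity_def
proof (intro conjI allI impI)
  fix i j assume ij: "i < n" "j < n" "i < m \<or> j < m"
  have X: "X \<in> carrier_mat n n"
    "\<And>i j. i < n \<Longrightarrow> j < n \<Longrightarrow> i < m \<or> j < m \<Longrightarrow> X $$ (i, j) = (if i = j then 1 else 0)"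
    using assms(1) by (auto simp: starts_with_identity_def)
  show "row_shear c w X $$ (i, j) = (if i = j then 1 else 0)"
    using X(2)[of i j] X(2)[of c j] ij assms(2-4) by (auto simp: row_shear_index[OF X(1)])
qed (use assms(1) in \<open>simp add: starts_with_identity_def\<close>)

lemma starts_with_identity_col_shear:
  assumes "starts_with_identity n m X" "m \<le> c" "c < n" "\<And>i. i < m \<Longrightarrow> w i = 0"
  shows "starts_with_identity n m (col_shear c w X)"
  unfolding starts_with_identity_def
proof (intro conjI allI impI)
  fix i j assume ij: "i < n" "j < n" "i < m \<or> j < m"
  have X: "X \<in> carrier_mat n n"
    "\<And>i j. i < n \<Longrightarrow> j < n \<Longrightarrow> i < m \<or> j < m \<Longrightarrow> X $$ (i, j) = (if i = j then 1 else 0)"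
    using assms(1) by (auto simp: starts_with_identity_def)
  show "col_shear c w X $$ (i, j) = (if i = j then 1 else 0)"
    using X(2)[of i j] X(2)[of i c] ij assms(2-4) by (auto simp: col_shear_index[OF X(1)])
qed (use assms(1) in \<open>simp add: starts_with_identity_def\<close>)

section \<open>Reduction to normal forms\<close>

context shear_closed begin

text \<open>The nonzero entry is wanted in row \<open>m\<close> but strictly to the right of the
  pivot position: adding a multiple of its column to column \<open>m\<close> can then give the pivot
  any prescribed value.\<close>

lemma move_nonzero_entry:
  assumes IH: "\<And>X b. starts_with_identity n m X \<Longrightarrow> m < b \<Longrightarrow> b < n \<Longrightarrow> X $$ (m, b) \<noteq> 0 \<Longrightarrow> X \<in> S"
    and X: "starts_with_identity n m X" and mn: "Suc m < n"
    and ab: "m \<le> a" "a < n" "m \<le> b" "b < n" "X $$ (a, b) \<noteq> 0"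
  shows "X \<in> S"
proof -
  have right: "Y \<in> S" if Y: "starts_with_identity n m Y"
    and ab: "m \<le> a" "a < n" "m < b" "b < n" "Y $$ (a, b) \<noteq> 0" for Y a b
  proof (cases "Y $$ (m, b) = 0")
    case True
    define w :: "nat \<Rightarrow> 'a" where "w i = (if i = m then 1 else 0)" for i
    have Yc: "Y \<in> carrier_mat n n" using Y by (simp add: starts_with_identity_def)
    have am: "a \<noteq> m" using True ab by auto
    have "row_shear a w Y \<in> S"
    proof (rule IH)
      show "starts_with_identity n m (row_shear a w Y)"
        using Y ab by (intro starts_with_identity_row_shear) (auto simp: w_def)
      show "row_shear a w Y $$ (m, b) \<noteq> 0"
        using True ab mn Yc by (simp add: row_shear_index w_def)
    qed (use ab in auto)
    then show ?thesis using row_shear_iff[of Y a w] Yc ab am by (auto simp: w_def)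
  qed (use IH Y ab in auto)
  show ?thesis
  proof (cases "m < b")
    case True
    then show ?thesis using right X ab by auto
  next
    case False
    then have b: "b = m" using ab by simp
    show ?thesis
    proof (cases "X $$ (a, Suc m) = 0")
      case True
      \<comment> \<open>The entry sits in the pivot column itself. Adding that column to its right
        neighbour, which exists because \<open>Suc m < n\<close>, makes an entry there
        nonzero.\<close>
      define w :: "nat \<Rightarrow> 'a" where "w i = (if i = Suc m then 1 else 0)" for i
      have Xc: "X \<in> carrier_mat n n" using X by (simp add: starts_with_identity_def)
      have "col_shear m w X \<in> S"
      proof (rule right)
        show "starts_with_identity n m (col_shear m w X)"
          using X ab mn by (intro starts_with_identity_col_shear) (auto simp: w_def)
        show "col_shear m w X $$ (a, Suc m) \<noteq> 0"
          using True ab mn Xc b by (simp add: col_shear_index w_def)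
      qed (use ab mn in auto)
      then show ?thesis using col_shear_iff[of X m w] Xc mn by (auto simp: w_def)
    qed (use right[of X a "Suc m"] X ab mn in auto)
  qed
qed

text \<open>The identity block grows until the remaining block is zero, which is the case
  \<open>idem\<close>, or has size 1. In the latter case the remaining entry cannot be normalized by
  determinant-preserving operations, and \<open>corner\<close> covers all its values.\<close>

lemma carrier_subset:
  assumes n: "n \<ge> 2"
    and idem: "\<And>m. m \<le> n \<Longrightarrow> mat n n (\<lambda>(i, j). if i = j \<and> i < m then 1 else 0) \<in> S"
    and corner: "\<And>b. mat n n (\<lambda>(i, j). if i = j \<or> i = n - 1 \<and> j = n - 2 then 1
                    else if i = n - 2 \<and> j = n - 1 then b else 0) \<in> S"
  shows "carrier_mat n n \<subseteq> S"
proof -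
  have main: "starts_with_identity n (n - 1 - t) X \<Longrightarrow> X \<in> S" for t X
  proof (induction t arbitrary: X)
    case 0
    then have X: "X \<in> carrier_mat n n"
      and Xij: "\<And>i j. i < n \<Longrightarrow> j < n \<Longrightarrow> i < n - 1 \<or> j < n - 1 \<Longrightarrow> X $$ (i, j) = (if i = j then 1 else 0)"
      by (auto simp: starts_with_identity_def)
    \<comment> \<open>Let \<delta> be the last diagonal entry. Adding row n - 2 to row n - 1 and
      then b times column n - 2 to column n - 1 turns the last 2 x 2 block into ((1, b), (1,
      \<delta> + b)); this b makes both diagonal entries 1.\<close>
    define b where "b = 1 - X $$ (n - 1, n - 1)"
    define w1 :: "nat \<Rightarrow> 'a" where "w1 i = (if i = n - 1 then 1 else 0)" for i
    define w2 :: "nat \<Rightarrow> 'a" where "w2 i = (if i = n - 1 then b else 0)" for i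
    have ne: "n - 2 \<noteq> n - 1" "n - 2 < n" "n - 2 < n - 1" using n by auto
    have "col_shear (n - 2) w2 (row_shear (n - 2) w1 X) = 
       mat n n (\<lambda>(i, j). if i = j \<or> i = n - 1 \<and> j = n - 2 then 1
                    else if i = n - 2 \<and> j = n - 1 then b else 0)"
    proof (rule eq_matI, goal_cases)
      case (1 i j)
      then have ij: "i < n" "j < n" by auto
      have e: "col_shear (n - 2) w2 (row_shear (n - 2) w1 X) $$ (i, j)
         = X $$ (i, j) + w1 i * X $$ (n - 2, j) + (X $$ (i, n - 2) + w1 i * X $$ (n - 2, n - 2)) * w2 j"
        using X ij ne by (simp add: col_shear_index[of _ n n] row_shear_index[of _ n n])
      have a1: "X $$ (i, n - 2) = (if i = n - 2 then 1 else 0)"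
        and a2: "X $$ (n - 2, j) = (if n - 2 = j then 1 else 0)"
        and a3: "X $$ (n - 2, n - 2) = 1"
        using Xij[of i "n - 2"] Xij[of "n - 2" j] Xij[of "n - 2" "n - 2"] ij ne n by auto
      have a4: "X $$ (i, j) = (if i = n - 1 \<and> j = n - 1 then 1 - b else if i = j then 1 else 0)"
      proof (cases "i = n - 1 \<and> j = n - 1")
        case False
        then have "i < n - 1 \<or> j < n - 1" using ij by linarith
        with Xij[OF ij this] False show ?thesis by auto
      qed (simp add: b_def)
      show ?case using ij ne by (auto simp: e a1 a2 a3 a4 w1_def w2_def)
    qed (use X in \<open>auto simp: col_shear_def row_shear_def\<close>)
    then have "col_shear (n - 2) w2 (row_shear (n - 2) w1 X) \<in> S" using corner by simp
    then show ?case
      using col_shear_iff[of "row_shear (n - 2) w1 X" "n - 2" w2] row_shear_iff[of X "n - 2" w1] X ne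
      by (auto simp: w1_def w2_def)
  next
    case (Suc t)
    define m where "m = n - 1 - Suc t"
    show ?case
    \<comment> \<open>Truncated subtraction: once \<open>t\<close> reaches \<open>n - 1\<close>,
      both sides are 0 and the induction hypothesis applies unchanged.\<close>
    proof (cases "n - 1 - t = m")
      case True
      then show ?thesis using Suc m_def by auto
    next
      case False
      then have m: "n - 1 - t = Suc m" "Suc m < n" using n m_def by auto
      have IH: "starts_with_identity n (Suc m) X \<Longrightarrow> X \<in> S" for X using Suc.IH[of X] m by simp
      have pivot: "Y \<in> S" if Y: "starts_with_identity n m Y" and Y1: "Y $$ (m, m) = 1" for Y
      proof -
        have Yc: "Y \<in> carrier_mat n n" and
          Yij: "\<And>i j. i < n \<Longrightarrow> j < n \<Longrightarrow> i < m \<or> j < m \<Longrightarrow> Y $$ (i, j) = (if i = j then 1 else 0)"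
          using Y by (auto simp: starts_with_identity_def)
        \<comment> \<open>Row \<open>m\<close> is cleared first by column operations. It is then a
          unit vector, so the row operations that clear column \<open>m\<close> disturb no other
          column.\<close>
        define w1 where "w1 j = (if m < j then - Y $$ (m, j) else 0)" for j
        define w2 where "w2 i = (if m < i then - Y $$ (i, m) else 0)" for i
        have "starts_with_identity n (Suc m) (row_shear m w2 (col_shear m w1 Y))"
          unfolding starts_with_identity_def
        proof (intro conjI allI impI)
          fix i j assume ij: "i < n" "j < n" "i < Suc m \<or> j < Suc m"
          have "row_shear m w2 (col_shear m w1 Y) $$ (i, j)
            = Y $$ (i, j) + Y $$ (i, m) * w1 j + w2 i * (Y $$ (m, j) + w1 j)"
            using Yc ij m Y1 by (simp add: col_shear_index[of _ n n] row_shear_index[of _ n n])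
          moreover have "i < m \<or> j < m \<or> i = m \<or> j = m" using ij by linarith
          ultimately show "row_shear m w2 (col_shear m w1 Y) $$ (i, j) = (if i = j then 1 else 0)"
            using Yij[of i j] Yij[of i m] Yij[of m j] ij m Y1
            by (cases i m rule: linorder_cases; cases j m rule: linorder_cases) (auto simp: w1_def w2_def)
        qed (use Yc in auto)
        then have "row_shear m w2 (col_shear m w1 Y) \<in> S" by (rule IH)
        then show ?thesis
          using row_shear_iff[of "col_shear m w1 Y" m w2] col_shear_iff[of Y m w1] Yc m
          by (auto simp: w1_def w2_def)
      qed
      have entry: "Y \<in> S" if Y: "starts_with_identity n m Y" and b: "m < b" "b < n" "Y $$ (m, b) \<noteq> 0" for Y b
      proof -
        have Yc: "Y \<in> carrier_mat n n" using Y by (auto simp: starts_with_identity_def)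
        \<comment> \<open>The pivot cannot be scaled; it is corrected to 1 by a multiple of column
          \<open>b\<close>.\<close>
        define w where "w j = (if j = m then (1 - Y $$ (m, m)) / Y $$ (m, b) else 0)" for j
        have "col_shear b w Y \<in> S"
        proof (rule pivot)
          show "starts_with_identity n m (col_shear b w Y)"
            using Y b by (intro starts_with_identity_col_shear) (auto simp: w_def)
          show "col_shear b w Y $$ (m, m) = 1" using Yc m b by (simp add: col_shear_index w_def)
        qed
        then show ?thesis using col_shear_iff[of Y b w] Yc b by (auto simp: w_def)
      qed
      have X: "starts_with_identity n m X" using Suc.prems m_def by simp
      show ?thesis
      proof (cases "\<exists>a b. m \<le> a \<and> a < n \<and> m \<le> b \<and> b < n \<and> X $$ (a, b) \<noteq> 0")
        case True
        then show ?thesis using move_nonzero_entry[of m X] entry X m by blast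
      next
        case False
        have "X = mat n n (\<lambda>(i, j). if i = j \<and> i < m then 1 else 0)"
        proof (rule eq_matI, goal_cases)
          case (1 i j)
          then have "m \<le> i \<Longrightarrow> m \<le> j \<Longrightarrow> X $$ (i, j) = 0" using False by auto
          with 1 show ?case
            using X by (cases "i < m \<or> j < m") (auto simp: starts_with_identity_def not_less)
        qed (use X in \<open>auto simp: starts_with_identity_def\<close>)
        then show ?thesis using idem[of m] m by simp
      qed
    qed
  qed
  show ?thesis
  proof
    fix X :: "'a mat" assume "X \<in> carrier_mat n n"
    then show "X \<in> S" using main[of "n - 1" X] by (simp add: starts_with_identity_def)
  qed
qed

text \<open>Once row 0 is \<open>d\<close> in the corner and nonzero in every other column, adding a
  multiple of row 0 to row \<open>i\<close> sets the entry (i, i) to \<open>d\<close>, independently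
  for each \<open>i\<close>.\<close>

lemma nonzero_subset:
  assumes n: "n \<ge> 2"
    and diag: "\<And>X. X \<in> carrier_mat n n \<Longrightarrow> (\<And>i. i < n \<Longrightarrow> X $$ (i, i) = d) \<Longrightarrow> X \<in> S"
    and X: "X \<in> carrier_mat n n" "X \<noteq> 0\<^sub>m n n"
  shows "X \<in> S"
proof -
  have entry: "Y \<in> S" if Y: "Y \<in> carrier_mat n n" and b: "0 < b" "b < n" "Y $$ (0, b) \<noteq> 0" for Y b
  proof -
    \<comment> \<open>Column \<open>b\<close> keeps its nonzero top entry; the top entries of the
      other columns become \<open>d\<close> in column 0 and 1 elsewhere.\<close>
    define w1 where "w1 j = (if j = b then 0 else ((if j = 0 then d else 1) - Y $$ (0, j)) / Y $$ (0, b))" for j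
    define Z where "Z = col_shear b w1 Y"
    have Z: "Z \<in> carrier_mat n n" using Y by (simp add: Z_def)
    have Z0: "Z $$ (0, 0) = d" using Y b by (simp add: Z_def col_shear_index w1_def)
    have Zj: "Z $$ (0, j) \<noteq> 0" if "0 < j" "j < n" for j
      using Y b that by (simp add: Z_def col_shear_index w1_def)
    define w2 where "w2 i = (if i = 0 then 0 else (d - Z $$ (i, i)) / Z $$ (0, i))" for i
    have "row_shear 0 w2 Z \<in> S"
    proof (rule diag)
      fix i assume "i < n"
      then show "row_shear 0 w2 Z $$ (i, i) = d"
        using Z Z0 Zj[of i] by (cases "i = 0") (auto simp: row_shear_index w2_def)
    qed (use Z in auto)
    then show ?thesis
      using row_shear_iff[of Z 0 w2] col_shear_iff[of Y b w1] Y Z b by (auto simp: w1_def w2_def Z_def)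
  qed
  have "\<exists>a<n. \<exists>b<n. X $$ (a, b) \<noteq> 0"
  proof (rule ccontr)
    assume "\<not> ?thesis"
    then have "X = 0\<^sub>m n n" using X(1) by (intro eq_matI) auto
    with X(2) show False by simp
  qed
  then obtain a b where ab: "a < n" "b < n" "X $$ (a, b) \<noteq> 0" by blast
  show ?thesis
  proof (rule move_nonzero_entry[of 0 X a b])
    show "starts_with_identity n 0 X" using X by (simp add: starts_with_identity_def)
    show "Y \<in> S" if "starts_with_identity n 0 Y" "0 < b" "b < n" "Y $$ (0, b) \<noteq> 0" for Y b
      using that entry by (simp add: starts_with_identity_def)
  qed (use ab n in auto)
qed

end

section \<open>Powers of matrices\<close>

lemma pow_mat_add:
  assumes "A \<in> carrier_mat n n"
  shows "A ^\<^sub>m (a + b) = A ^\<^sub>m a * A ^\<^sub>m b"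
  using assms
  by (induction b) (simp_all add: assoc_mult_mat[of _ n n _ n _ n] right_mult_one_mat[of _ n n])

lemma pow_mat_mult:
  assumes "A \<in> carrier_mat n n"
  shows "A ^\<^sub>m (a * b) = (A ^\<^sub>m a) ^\<^sub>m b"
proof (induction b)
  case (Suc b)
  have "A ^\<^sub>m (a * Suc b) = A ^\<^sub>m (a * b + a)" by (simp add: add.commute)
  then show ?case using Suc pow_mat_add[OF assms, of "a * b" a] by simp
qed (use assms in simp)

lemma pow_mat_one: "1\<^sub>m n ^\<^sub>m k = 1\<^sub>m n"
  by (induction k) auto

lemma pow_mat_scalar: "(c \<cdot>\<^sub>m 1\<^sub>m n) ^\<^sub>m k = (c ^ k :: 'a::field) \<cdot>\<^sub>m 1\<^sub>m n"
  by (induction k) (auto simp: mult.commute intro!: eq_matI)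

lemma pow_mat_transpose:
  fixes A :: "'a::comm_ring_1 mat"
  assumes A: "A \<in> carrier_mat n n"
  shows "(A\<^sup>T) ^\<^sub>m k = (A ^\<^sub>m k)\<^sup>T"
proof (induction k)
  case (Suc k)
  have "A ^\<^sub>m Suc k = A * A ^\<^sub>m k" using pow_mat_add[OF A, of 1 k] A by simp
  then show ?case using Suc A by (simp add: transpose_mult[of _ n n _ n])
qed (use A in simp)

lemma pow_mat_conjugate:
  fixes A :: "'a::field mat"
  assumes A: "A \<in> carrier_mat n n" and P: "P \<in> carrier_mat n n" "P' \<in> carrier_mat n n" "P * P' = 1\<^sub>m n"
  shows "(P * A * P') ^\<^sub>m k = P * A ^\<^sub>m k * P'"
proof -
  have "P' * P = 1\<^sub>m n" using mat_mult_left_right_inverse P by blast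
  then have "similar_mat_wit (P * A * P') A P P'"
    using A P by (intro similar_mat_witI[of _ _ n]) (auto simp: mult_carrier_mat[of _ n n _ n])
  then show ?thesis by (rule similar_mat_wit_pow_id)
qed

lemma pow_mat_idempotent:
  assumes "A \<in> carrier_mat n n" "A * A = A" "k \<ge> 1"
  shows "A ^\<^sub>m k = A"
  using assms(3) by (induction k rule: dec_induct) (use assms(1,2) in simp_all)

text \<open>Unipotent upper triangular with the superdiagonals \<open>1, \<dots>, s - 1\<close> equal to zero; the \<open>p\<close>-th power
  increases \<open>s\<close> by one in characteristic \<open>p\<close>.\<close>

definition unitriangular :: "nat \<Rightarrow> nat \<Rightarrow> 'a::field mat \<Rightarrow> bool" where
  "unitriangular n s A \<longleftrightarrow> A \<in> carrier_mat n n \<and>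
     (\<forall>i<n. \<forall>j<n. j < i + s \<longrightarrow> A $$ (i, j) = (if i = j then 1 else 0))"

text \<open>Write the factors as I + A' and I + B'. The product A' B' starts at superdiagonal 2s,
  beyond s, so up to superdiagonal s the nilpotent parts simply add. Consequently the r-th power
  multiplies superdiagonal s by r.\<close>

lemma unitriangular_mult_index:
  assumes A: "unitriangular n s A" and B: "unitriangular n s B" and s: "s \<ge> 1"
    and ij: "i < n" "j < n" "j \<le> i + s"
  shows "(A * B) $$ (i, j) = (if i = j then 1 else A $$ (i, j) + B $$ (i, j))"
proof -
  have Aij: "A $$ (i, j) = (if i = j then 1 else 0)" if "i < n" "j < n" "j < i + s" for i j
    using A that by (auto simp: unitriangular_def)
  have Bij: "B $$ (i, j) = (if i = j then 1 else 0)" if "i < n" "j < n" "j < i + s" for i j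
    using B that by (auto simp: unitriangular_def)
  have c: "A \<in> carrier_mat n n" "B \<in> carrier_mat n n" using A B by (auto simp: unitriangular_def)
  have AB: "(A * B) $$ (i, j) = (\<Sum>l<n. A $$ (i, l) * B $$ (l, j))"
    using c ij by (auto simp: scalar_prod_def lessThan_atLeast0 intro!: sum.cong)
  have z: "A $$ (i, l) * B $$ (l, j) = 0" if l: "l < n" "l \<noteq> i" "l \<noteq> j" for l
  proof (cases "l < i + s")
    case True
    then show ?thesis using Aij[of i l] l ij by simp
  next
    case False
    then show ?thesis using Bij[of l j] l ij s by simp
  qed
  show ?thesis
  proof (cases "i = j")
    case True
    have "(A * B) $$ (i, j) = (\<Sum>l<n. if l = i then 1 else 0)"
      unfolding AB using z Aij[of i i] Bij[of i i] ij s True by (intro sum.cong) auto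
    then show ?thesis using True ij by simp
  next
    case False
    have "(A * B) $$ (i, j) = (\<Sum>l<n. (if l = i then B $$ (i, j) else 0) + (if l = j then A $$ (i, j) else 0))"
      unfolding AB using z Aij[of i i] Bij[of j j] ij s False by (intro sum.cong) auto
    then show ?thesis using False ij by (simp add: sum.distrib)
  qed
qed

lemma unitriangular_pow:
  assumes A: "unitriangular n s A" and s: "s \<ge> 1"
  shows "unitriangular n s (A ^\<^sub>m r) \<and>
    (\<forall>i j. i < n \<and> j < n \<and> j = i + s \<longrightarrow> (A ^\<^sub>m r) $$ (i, j) = of_nat r * A $$ (i, j))"
proof (induction r)
  case 0
  then show ?case using A s by (auto simp: unitriangular_def)
next
  case (Suc r)
  have c: "A \<in> carrier_mat n n" using A by (auto simp: unitriangular_def)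
  note ix = unitriangular_mult_index[OF Suc[THEN conjunct1] A s]
  have "unitriangular n s (A ^\<^sub>m r * A)"
    unfolding unitriangular_def
  proof (intro conjI allI impI)
    fix i j assume ij: "i < n" "j < n" "j < i + s"
    then show "(A ^\<^sub>m r * A) $$ (i, j) = (if i = j then 1 else 0)"
      using ix[of i j] A Suc by (auto simp: unitriangular_def)
  qed (use c in \<open>simp add: mult_carrier_mat[of _ n n _ n]\<close>)
  moreover have "(A ^\<^sub>m r * A) $$ (i, j) = of_nat (Suc r) * A $$ (i, j)"
    if ij: "i < n" "j < n" "j = i + s" for i j
  proof -
    have "(A ^\<^sub>m r) $$ (i, j) = of_nat r * A $$ (i, j)" using Suc ij by blast
    then show ?thesis using ix[of i j] ij s by (simp add: algebra_simps)
  qed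
  ultimately show ?case by simp
qed

lemma unitriangular_pow_char:
  fixes A :: "'a::field mat"
  assumes A: "unitriangular n s A" and s: "s \<ge> 1" and p: "of_nat p = (0::'a)"
  shows "unitriangular n (Suc s) (A ^\<^sub>m p)"
  unfolding unitriangular_def
proof (intro conjI allI impI)
  fix i j assume ij: "i < n" "j < n" "j < i + Suc s"
  show "(A ^\<^sub>m p) $$ (i, j) = (if i = j then 1 else 0)"
  proof (cases "j = i + s")
    case True
    then show ?thesis using unitriangular_pow[OF A s, of p] ij p s by auto
  next
    case False
    then show ?thesis using unitriangular_pow[OF A s, of p] ij by (auto simp: unitriangular_def)
  qed
qed (use A in \<open>simp add: unitriangular_def\<close>)

lemma unitriangular_pow_char_pow:
  fixes A :: "'a::field mat"
  assumes A: "unitriangular n 1 A" and p: "of_nat p = (0::'a)"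
  shows "A ^\<^sub>m (p ^ n) = 1\<^sub>m n"
proof -
  have c: "A \<in> carrier_mat n n" using A by (simp add: unitriangular_def)
  have "unitriangular n (Suc e) (A ^\<^sub>m (p ^ e))" for e
  proof (induction e)
    case 0
    then show ?case using A c by simp
  next
    case (Suc e)
    have "A ^\<^sub>m (p ^ Suc e) = (A ^\<^sub>m (p ^ e)) ^\<^sub>m p"
      using pow_mat_mult[OF c, of "p ^ e" p] by (simp add: mult.commute)
    then show ?case using unitriangular_pow_char[OF Suc _ p] by simp
  qed
  \<comment> \<open>Every pair of indices below \<open>n\<close> now satisfies
    \<open>j < i + Suc n\<close>, so all entries are determined.\<close>
  from this[of n] show ?thesis by (intro eq_matI) (auto simp: unitriangular_def)
qed

lemma GL_iff: "A \<in> GL n \<longleftrightarrow> A \<in> carrier_mat n n \<and> (\<exists>B \<in> carrier_mat n n. A * B = 1\<^sub>m n)"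
proof
  assume "A \<in> GL n"
  then have A: "A \<in> carrier_mat n n" and "invertible_mat A" by (auto simp: GL_def)
  then obtain B where B: "A * B = 1\<^sub>m n" "B * A = 1\<^sub>m (dim_row B)"
    by (auto simp: invertible_mat_def inverts_mat_def)
  have "B \<in> carrier_mat n n"
    using A arg_cong[OF B(1), of dim_col] arg_cong[OF B(2), of dim_col] by auto
  then show "A \<in> carrier_mat n n \<and> (\<exists>B \<in> carrier_mat n n. A * B = 1\<^sub>m n)" using A B by blast
next
  assume "A \<in> carrier_mat n n \<and> (\<exists>B \<in> carrier_mat n n. A * B = 1\<^sub>m n)"
  then obtain B where A: "A \<in> carrier_mat n n" and B: "B \<in> carrier_mat n n" "A * B = 1\<^sub>m n" by blast
  have "B * A = 1\<^sub>m n" using mat_mult_left_right_inverse A B by blast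
  then show "A \<in> GL n" using A B by (auto simp: GL_def invertible_mat_def inverts_mat_def)
qed

text \<open>The order of \<open>A\<close> divides \<open>p ^ n\<close>, so inverting
  \<open>k\<close> modulo \<open>p ^ n\<close> gives an exponent \<open>a\<close> for which
  \<open>A ^\<^sub>m a\<close> is a \<open>k\<close>-th root.\<close>

lemma unitriangular_root:
  fixes A :: "'a::{field, finite} mat"
  assumes A: "unitriangular n 1 A" and p: "of_nat p = (0::'a)" "p > 0" and k: "k > 0" "coprime k p"
  shows "\<exists>B \<in> GL n. B ^\<^sub>m k = A"
proof -
  have c: "A \<in> carrier_mat n n" using A by (simp add: unitriangular_def)
  have A1: "A ^\<^sub>m (p ^ n) = 1\<^sub>m n" by (rule unitriangular_pow_char_pow[OF A p(1)])
  have "coprime k (p ^ n)" using k by simp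
  then obtain a b where ab: "k * a = p ^ n * b + 1"
    using bezout_nat[of k "p ^ n"] k by auto
  have "(A ^\<^sub>m a) ^\<^sub>m k = A ^\<^sub>m (p ^ n * b + 1)"
    using pow_mat_mult[OF c, of a k] ab by (simp add: mult.commute)
  also have "\<dots> = A"
    using pow_mat_mult[OF c, of "p ^ n" b] pow_mat_add[OF c, of "p ^ n * b" 1] A1 c
    by (simp add: pow_mat_one)
  finally have root: "(A ^\<^sub>m a) ^\<^sub>m k = A" .
  \<comment> \<open>The root is invertible because a complementary power of \<open>A\<close> is its
    inverse.\<close>
  have "A ^\<^sub>m a * A ^\<^sub>m (a * (p ^ n - 1)) = A ^\<^sub>m (p ^ n * a)"
  proof -
    have "a + a * (p ^ n - 1) = p ^ n * a" using p(2) by (simp add: algebra_simps)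
    then show ?thesis using pow_mat_add[OF c, of a "a * (p ^ n - 1)"] by simp
  qed
  also have "\<dots> = 1\<^sub>m n" using pow_mat_mult[OF c, of "p ^ n" a] A1 by (simp add: pow_mat_one)
  finally have "A ^\<^sub>m a \<in> GL n" unfolding GL_iff using c by (auto intro: pow_carrier_mat)
  with root show ?thesis by blast
qed

section \<open>Finite fields and invertible matrices\<close>

lemma of_nat_CARD_eq_0: "of_nat CARD('a) = (0 :: 'a::{field, finite})"
proof -
  \<comment> \<open>Translation by 1 permutes the field, and the two sums differ by the
    cardinality.\<close>
  have "(\<Sum>y\<in>UNIV. y + 1) = (\<Sum>y\<in>UNIV. (y::'a))"
    by (rule sum.reindex_bij_witness[of _ "\<lambda>y. y - 1" "\<lambda>y. y + 1"]) auto
  then show ?thesis by (simp add: sum.distrib)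
qed

lemma power_CARD_minus_1:
  fixes x :: "'a::{field, finite}"
  assumes "x \<noteq> 0"
  shows "x ^ (CARD('a) - 1) = 1"
proof -
  \<comment> \<open>Multiplication by \<open>x\<close> permutes the nonzero elements, whose product
    can be cancelled.\<close>
  have "(\<Prod>y\<in>UNIV - {0}. x * y) = (\<Prod>y\<in>UNIV - {0}. y)"
    by (rule prod.reindex_bij_witness[of _ "\<lambda>y. y / x" "\<lambda>y. x * y"]) (use assms in auto)
  then have "x ^ (CARD('a) - 1) * \<Prod>(UNIV - {0::'a}) = 1 * \<Prod>(UNIV - {0::'a})"
    by (simp add: prod.distrib)
  then show ?thesis by simp
qed

lemma GL_transpose: "A \<in> GL n \<Longrightarrow> A\<^sup>T \<in> GL n"
proof -
  assume "A \<in> GL n"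
  then obtain B where A: "A \<in> carrier_mat n n" and B: "B \<in> carrier_mat n n" "A * B = 1\<^sub>m n"
    unfolding GL_iff by blast
  have "B * A = 1\<^sub>m n" using mat_mult_left_right_inverse A B by blast
  then have "A\<^sup>T * B\<^sup>T = 1\<^sub>m n" using A B by (metis transpose_mult transpose_one)
  then show ?thesis unfolding GL_iff using A B by auto
qed

lemma GL_conjugate:
  assumes "A \<in> GL n" and P: "P \<in> carrier_mat n n" "P' \<in> carrier_mat n n" "P * P' = 1\<^sub>m n"
  shows "P * A * P' \<in> GL n"
proof -
  obtain B where A: "A \<in> carrier_mat n n" and B: "B \<in> carrier_mat n n" "A * B = 1\<^sub>m n"
    using assms(1) unfolding GL_iff by blast
  have P'P: "P' * P = 1\<^sub>m n" using mat_mult_left_right_inverse P by blast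
  have "P * A * P' * (P * B * P') = P * (A * ((P' * P) * (B * P')))"
    using A B(1) P(1,2) by (simp add: assoc_mult_mat[of _ n n _ n _ n] mult_carrier_mat[of _ n n _ n])
  also have "\<dots> = P * ((A * B) * P')"
    unfolding P'P using A B(1) P(1,2) by (simp add: assoc_mult_mat[of _ n n _ n _ n] mult_carrier_mat[of _ n n _ n])
  also have "\<dots> = 1\<^sub>m n" unfolding B(2) using P by simp
  finally show ?thesis unfolding GL_iff
    using A B P by (auto simp: mult_carrier_mat[of _ n n _ n] intro!: bexI[of _ "P * B * P'"])
qed

section \<open>Sums of two powers\<close>

text \<open>The common form of \<open>P_set\<close> and \<open>Q_set\<close>: only transposition and
  conjugation invariance of \<open>G\<close> matter for the stabilizer argument.\<close>

definition power_sums :: "nat \<Rightarrow> 'a::field mat set \<Rightarrow> 'a mat set" where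
  "power_sums k G = {A ^\<^sub>m k + B ^\<^sub>m k | A B. A \<in> G \<and> B \<in> G}"

lemma P_set_eq_power_sums: "P_set k n = power_sums k (carrier_mat n n)"
  and Q_set_eq_power_sums: "Q_set k n = power_sums k (GL n)"
  by (auto simp: P_set_def Q_set_def power_sums_def)

lemma power_sums_carrier: "G \<subseteq> carrier_mat n n \<Longrightarrow> power_sums k G \<subseteq> carrier_mat n n"
  unfolding power_sums_def by (auto intro!: add_carrier_mat pow_carrier_mat)

lemma power_sums_transpose:
  fixes G :: "'a::field mat set"
  assumes G: "G \<subseteq> carrier_mat n n" "\<And>A. A \<in> G \<Longrightarrow> A\<^sup>T \<in> G" and X: "X \<in> power_sums k G"
  shows "X\<^sup>T \<in> power_sums k G"
proof -
  obtain A B where X: "X = A ^\<^sub>m k + B ^\<^sub>m k" and AB: "A \<in> G" "B \<in> G"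
    using X by (auto simp: power_sums_def)
  have c: "A \<in> carrier_mat n n" "B \<in> carrier_mat n n" using AB G by auto
  have "X\<^sup>T = (A\<^sup>T) ^\<^sub>m k + (B\<^sup>T) ^\<^sub>m k"
    unfolding X pow_mat_transpose[OF c(1)] pow_mat_transpose[OF c(2)]
    using c by (intro transpose_add[of _ n n]) auto
  then show ?thesis using AB G(2) by (auto simp: power_sums_def)
qed

lemma power_sums_conjugate:
  fixes G :: "'a::field mat set"
  assumes G: "G \<subseteq> carrier_mat n n" "\<And>A. A \<in> G \<Longrightarrow> P * A * P' \<in> G"
    and P: "P \<in> carrier_mat n n" "P' \<in> carrier_mat n n" "P * P' = 1\<^sub>m n"
    and X: "X \<in> power_sums k G"
  shows "P * X * P' \<in> power_sums k G"
proof -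
  obtain A B where X: "X = A ^\<^sub>m k + B ^\<^sub>m k" and AB: "A \<in> G" "B \<in> G"
    using X by (auto simp: power_sums_def)
  have c: "A \<in> carrier_mat n n" "B \<in> carrier_mat n n" using AB G by auto
  have "P * X * P' = (P * A * P') ^\<^sub>m k + (P * B * P') ^\<^sub>m k"
    unfolding X pow_mat_conjugate[OF c(1) P] pow_mat_conjugate[OF c(2) P]
    using c P(1,2)
    by (simp add: mult_add_distrib_mat[of _ n n _ n] add_mult_distrib_mat[of _ n n _ _ n] mult_carrier_mat[of _ n n _ n])
  then show ?thesis using AB G(2) by (auto simp: power_sums_def)
qed

text \<open>This form is symmetric in \<open>A\<close> and its inverse, which turns the equality of
  sets into closure conditions and makes closure under inverses immediate.\<close>

lemma left_stabilizer_iff: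
  assumes S: "S \<subseteq> carrier_mat n n"
  shows "A \<in> left_stabilizer n S \<longleftrightarrow> A \<in> carrier_mat n n \<and>
    (\<exists>B \<in> carrier_mat n n. A * B = 1\<^sub>m n \<and> B * A = 1\<^sub>m n \<and> (\<forall>s\<in>S. A * s \<in> S) \<and> (\<forall>s\<in>S. B * s \<in> S))"
proof
  assume "A \<in> left_stabilizer n S"
  then have "A \<in> GL n" and AS: "{A * s | s. s \<in> S} = S" by (auto simp: left_stabilizer_def)
  then obtain B where A: "A \<in> carrier_mat n n" and B: "B \<in> carrier_mat n n" "A * B = 1\<^sub>m n"
    unfolding GL_iff by blast
  have BA: "B * A = 1\<^sub>m n" using mat_mult_left_right_inverse A B by blast
  have "B * s \<in> S" if s: "s \<in> S" for s
  proof -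
    obtain t where t: "t \<in> S" "s = A * t" using s AS by blast
    then have "t \<in> carrier_mat n n" using S by auto
    then have "B * s = (B * A) * t" using t A B by (simp add: assoc_mult_mat[of _ n n _ n _ n])
    then show ?thesis using BA t S by auto
  qed
  moreover have "\<forall>s\<in>S. A * s \<in> S" using AS by blast
  ultimately show "A \<in> carrier_mat n n \<and>
    (\<exists>B \<in> carrier_mat n n. A * B = 1\<^sub>m n \<and> B * A = 1\<^sub>m n \<and> (\<forall>s\<in>S. A * s \<in> S) \<and> (\<forall>s\<in>S. B * s \<in> S))"
    using A B BA by blast
next
  assume "A \<in> carrier_mat n n \<and>
    (\<exists>B \<in> carrier_mat n n. A * B = 1\<^sub>m n \<and> B * A = 1\<^sub>m n \<and> (\<forall>s\<in>S. A * s \<in> S) \<and> (\<forall>s\<in>S. B * s \<in> S))"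
  then obtain B where A: "A \<in> carrier_mat n n" "\<forall>s\<in>S. A * s \<in> S"
    and B: "B \<in> carrier_mat n n" "A * B = 1\<^sub>m n" "B * A = 1\<^sub>m n" "\<forall>s\<in>S. B * s \<in> S" by blast
  have "\<exists>t\<in>S. s = A * t" if s: "s \<in> S" for s
  proof
    have "s \<in> carrier_mat n n" using s S by auto
    then have "A * (B * s) = (A * B) * s" using A(1) B(1) by (simp add: assoc_mult_mat[of _ n n _ n _ n])
    then show "s = A * (B * s)" unfolding B(2) using \<open>s \<in> carrier_mat n n\<close> by simp
  qed (use s B in blast)
  then have "{A * s | s. s \<in> S} = S" using A by blast
  then show "A \<in> left_stabilizer n S" using A B by (auto simp: left_stabilizer_def GL_iff)
qed

text \<open>For conjugation, (P A P') s = P (A (P' s P)) P': first \<open>s\<close> is conjugated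
  within \<open>S\<close>, then \<open>A\<close> acts, then the result is conjugated back.\<close>

lemma left_stabilizer_normal:
  assumes S: "S \<subseteq> carrier_mat n n"
    and conj: "\<And>P P' X. P \<in> carrier_mat n n \<Longrightarrow> P' \<in> carrier_mat n n \<Longrightarrow> P * P' = 1\<^sub>m n \<Longrightarrow>
      X \<in> S \<Longrightarrow> P * X * P' \<in> S"
  shows "normal_matrices n (left_stabilizer n S)"
proof
  note ls = left_stabilizer_iff[OF S]
  note asc = assoc_mult_mat[of _ n n _ n _ n] mult_carrier_mat[of _ n n _ n]
  fix A :: "'a mat" assume "A \<in> left_stabilizer n S"
  then obtain A' where A: "A \<in> carrier_mat n n" "\<And>s. s \<in> S \<Longrightarrow> A * s \<in> S"
    and A': "A' \<in> carrier_mat n n" "A * A' = 1\<^sub>m n" "A' * A = 1\<^sub>m n" "\<And>s. s \<in> S \<Longrightarrow> A' * s \<in> S"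
    unfolding ls by blast
  show "A \<in> carrier_mat n n" by fact
  show "\<exists>B\<in>left_stabilizer n S. A * B = 1\<^sub>m n"
    using A A' by (intro bexI[of _ A']) (auto simp: ls)
  have swap: "X * Y * (Y' * X') = 1\<^sub>m n"
    if "X \<in> carrier_mat n n" "Y \<in> carrier_mat n n" "Y' \<in> carrier_mat n n" "X' \<in> carrier_mat n n"
      "X * X' = 1\<^sub>m n" "Y * Y' = 1\<^sub>m n" for X Y X' Y' :: "'a mat"
  proof -
    have "X * Y * (Y' * X') = X * ((Y * Y') * X')" using that(1-4) by (simp add: asc)
    then show ?thesis unfolding that(6) using that by simp
  qed
  {
    fix B :: "'a mat" assume "B \<in> left_stabilizer n S"
    then obtain B' where B: "B \<in> carrier_mat n n" "\<And>s. s \<in> S \<Longrightarrow> B * s \<in> S"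
      and B': "B' \<in> carrier_mat n n" "B * B' = 1\<^sub>m n" "B' * B = 1\<^sub>m n" "\<And>s. s \<in> S \<Longrightarrow> B' * s \<in> S"
      unfolding ls by blast
    have "(A * B) * s \<in> S" "(B' * A') * s \<in> S" if s: "s \<in> S" for s
    proof -
      have sc: "s \<in> carrier_mat n n" using s S by auto
      then have "(A * B) * s = A * (B * s)" "(B' * A') * s = B' * (A' * s)"
        using A(1) A'(1) B(1) B'(1) by (simp_all add: asc)
      then show "(A * B) * s \<in> S" "(B' * A') * s \<in> S" using A A' B B' s by auto
    qed
    then show "A * B \<in> left_stabilizer n S"
      unfolding ls using A A' B B' swap[of A B B' A'] swap[of B' A' A B]
      by (intro conjI bexI[of _ "B' * A'"]) (auto simp: mult_carrier_mat[of _ n n _ n])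
  }
  fix P P' :: "'a mat" assume P: "P \<in> carrier_mat n n" "P' \<in> carrier_mat n n" "P * P' = 1\<^sub>m n"
  have P'P: "P' * P = 1\<^sub>m n" using mat_mult_left_right_inverse P by blast
  have act: "(P * C * P') * s \<in> S" if C: "C \<in> carrier_mat n n" "\<And>s. s \<in> S \<Longrightarrow> C * s \<in> S" and s: "s \<in> S" for C s
  proof -
    have sc: "s \<in> carrier_mat n n" using s S by auto
    have "(P * C * P') * s = P * C * (P' * s * (P * P'))"
      unfolding P(3) using P(1,2) C sc by (simp add: asc right_mult_one_mat[of _ n n])
    also have "\<dots> = P * (C * (P' * s * P)) * P'" using P(1,2) C sc by (simp add: asc)
    finally show ?thesis using conj[OF P C(2)[OF conj[OF P(2,1) P'P s]]] by simp
  qed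
  have cancel: "(P * C * P') * (P * D * P') = 1\<^sub>m n"
    if "C \<in> carrier_mat n n" "D \<in> carrier_mat n n" "C * D = 1\<^sub>m n" for C D
  proof -
    have "(P * C * P') * (P * D * P') = P * (C * ((P' * P) * (D * P')))" using P(1,2) that(1,2) by (simp add: asc)
    also have "\<dots> = P * ((C * D) * P')" unfolding P'P using P(1,2) that(1,2) by (simp add: asc)
    finally show ?thesis unfolding that(3) using P by simp
  qed
  show "P * A * P' \<in> left_stabilizer n S"
    unfolding ls using A A' P act cancel
    by (intro conjI bexI[of _ "P * A' * P'"]) (auto simp: mult_carrier_mat[of _ n n _ n])
qed

lemma row_shear_eq_transvection_mult:
  fixes X :: "'a::field mat"
  assumes X: "X \<in> carrier_mat n m" and c: "c < n"
  shows "row_shear c w X = transvection (vec n w) (unit_vec n c) * X"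
proof (rule eq_matI, goal_cases)
  case (1 i j)
  then have ij: "i < n" "j < m" using X by (auto simp: transvection_def)
  have "(transvection (vec n w) (unit_vec n c) * X) $$ (i, j)
      = (\<Sum>l<n. (if l = i then X $$ (i, j) else 0) + (if l = c then w i * X $$ (c, j) else 0))"
    using X ij c
    by (auto simp: transvection_def scalar_prod_def lessThan_atLeast0 algebra_simps intro!: sum.cong)
  then show ?case using X ij c by (simp add: sum.distrib row_shear_index)
qed (use X in \<open>auto simp: row_shear_def transvection_def\<close>)

text \<open>A row shear is left multiplication by I + w e^T with e the unit vector at
  \<open>c\<close>; the condition \<open>w c = 0\<close> is exactly the orthogonality required of a
  transvection. Column shears are row shears of the transpose.\<close>

lemma shear_closedI:
  fixes S :: "'a::field mat set"
  assumes S: "S \<subseteq> carrier_mat n n" "\<And>X. X \<in> S \<Longrightarrow> X\<^sup>T \<in> S"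
    and T: "\<And>x f X. x \<in> carrier_vec n \<Longrightarrow> f \<in> carrier_vec n \<Longrightarrow> f \<bullet> x = 0 \<Longrightarrow> X \<in> S \<Longrightarrow> transvection x f * X \<in> S"
  shows "shear_closed n S"
proof
  fix X :: "'a mat" and c and w :: "nat \<Rightarrow> 'a"
  assume X: "X \<in> S" "X \<in> carrier_mat n n" and c: "c < n" "w c = 0"
  have row: "row_shear c w Y \<in> S" if "Y \<in> S" for Y
  proof -
    have Y: "Y \<in> carrier_mat n n" using that S by auto
    show ?thesis unfolding row_shear_eq_transvection_mult[OF Y c(1)] using c that by (intro T) auto
  qed
  show "row_shear c w X \<in> S" by (rule row[OF X(1)])
  have "col_shear c w X = (row_shear c w (X\<^sup>T))\<^sup>T"
    using X c by (intro eq_matI) (auto simp: row_shear_def col_shear_def)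
  then show "col_shear c w X \<in> S" using S(2) row X(1) by simp
qed

lemma power_sums_shear_closed:
  fixes G :: "'a::{field, finite} mat set"
  assumes G: "G \<subseteq> carrier_mat n n" "\<And>A. A \<in> G \<Longrightarrow> A\<^sup>T \<in> G"
      "\<And>A P P'. A \<in> G \<Longrightarrow> P \<in> carrier_mat n n \<Longrightarrow> P' \<in> carrier_mat n n \<Longrightarrow> P * P' = 1\<^sub>m n \<Longrightarrow> P * A * P' \<in> G"
    and g: "g \<in> left_stabilizer n (power_sums k G)" "\<And>a. g \<noteq> a \<cdot>\<^sub>m 1\<^sub>m n"
    and n: "n \<ge> 3 \<or> n = 2 \<and> (\<exists>r::'a. r \<noteq> 0 \<and> r\<^sup>2 \<noteq> 1)"
  shows "shear_closed n (power_sums k G)"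
proof -
  have S: "power_sums k G \<subseteq> carrier_mat n n" by (rule power_sums_carrier[OF G(1)])
  interpret normal_matrices n "left_stabilizer n (power_sums k G)"
    by (rule left_stabilizer_normal[OF S]) (rule power_sums_conjugate[OF G(1)], auto intro: G(3))
  show ?thesis
  proof (rule shear_closedI[OF S power_sums_transpose[OF G(1,2)]])
    fix x f :: "'a vec" and X
    assume x: "x \<in> carrier_vec n" "f \<in> carrier_vec n" "f \<bullet> x = 0" and X: "X \<in> power_sums k G"
    have "transvection x f \<in> left_stabilizer n (power_sums k G)"
      by (rule transvection_mem[OF g n x])
    then show "transvection x f * X \<in> power_sums k G" using X by (auto simp: left_stabilizer_iff[OF S])
  qed auto
qed

section \<open>Writing the normal forms as sums of two powers\<close>

lemma idempotent_sum_mem_P_set: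
  assumes "E \<in> carrier_mat n n" "E * E = E" "F \<in> carrier_mat n n" "F * F = F" "k \<ge> 1"
  shows "E + F \<in> P_set k n"
  using assms pow_mat_idempotent[of E n k] pow_mat_idempotent[of F n k] unfolding P_set_def by force

text \<open>With pairing -1 the map sends \<open>x\<close> to 0 and fixes the kernel of
  \<open>f\<close>: it is the projection onto that kernel along \<open>x\<close>.\<close>

lemma transvection_idempotent:
  fixes x :: "'a::field vec"
  assumes x: "x \<in> carrier_vec n" and f: "f \<in> carrier_vec n" "f \<bullet> x = - 1"
  shows "transvection x f * transvection x f = transvection x f"
proof -
  have "x + x + (f \<bullet> x) \<cdot>\<^sub>v x = x" unfolding f(2) using x by (intro eq_vecI) auto
  then show ?thesis using transvection_mult[OF x x f(1)] by simp
qed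

text \<open>The complementary kind of projection, onto the line of \<open>x\<close> along the kernel
  of \<open>f\<close>.\<close>

lemma outer_product_idempotent:
  fixes x :: "'a::field vec"
  assumes x: "x \<in> carrier_vec n" and f: "f \<in> carrier_vec n" "f \<bullet> x = 1"
  defines "F \<equiv> mat n n (\<lambda>(i, j). x $ i * f $ j)"
  shows "F * F = F"
proof (rule eq_matI, goal_cases)
  case (1 i j)
  then have ij: "i < n" "j < n" by (auto simp: F_def)
  have "(F * F) $$ (i, j) = x $ i * (f \<bullet> x) * f $ j"
    using ij x by (simp add: F_def scalar_prod_def sum_distrib_left sum_distrib_right mult_ac)
  then show ?case using ij f by (simp add: F_def)
qed (auto simp: F_def)

lemma P_set_eq_carrier:
  assumes "shear_closed n (P_set k n :: 'a::{field, finite} mat set)" and n: "n \<ge> 2" and k: "k \<ge> 1"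
  shows "(P_set k n :: 'a mat set) = carrier_mat n n"
proof
  interpret shear_closed n "P_set k n :: 'a mat set" by fact
  show "(P_set k n :: 'a mat set) \<subseteq> carrier_mat n n"
    unfolding P_set_eq_power_sums by (rule power_sums_carrier) simp
  show "carrier_mat n n \<subseteq> (P_set k n :: 'a mat set)"
  proof (rule carrier_subset[OF n])
    fix m
    let ?E = "mat n n (\<lambda>(i, j). if i = j \<and> i < m then 1 else 0) :: 'a mat"
    have E: "?E = mat_diag n (\<lambda>i. if i < m then 1 else 0)"
      by (intro eq_matI) (auto simp: mat_diag_def)
    have "?E * ?E = ?E" unfolding E by (simp add: if_distrib cong: if_cong)
    then have "?E + 0\<^sub>m n n \<in> P_set k n" using k by (intro idempotent_sum_mem_P_set) auto
    moreover have "?E + 0\<^sub>m n n = ?E" by (rule right_add_zero_mat) simp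
    ultimately show "?E \<in> P_set k n" by simp
  next
    fix b :: 'a
    \<comment> \<open>In the last 2 x 2 block the decomposition is ((1, b), (1, 1)) = ((1, b), (0,
      0)) + ((0, 0), (1, 1)). The first summand, with ones on the rest of the diagonal, is I + x e^T
      for the last unit vector e; the second is e f^T.\<close>
    define x where "x = vec n (\<lambda>i. if i = n - 1 then - 1 else if i = n - 2 then b else 0)"
    define f where "f = vec n (\<lambda>i. if i = n - 1 \<or> i = n - 2 then 1 else (0::'a))"
    have "unit_vec n (n - 1) \<bullet> x = - 1" using n by (simp add: x_def)
    then have E: "transvection x (unit_vec n (n - 1)) * transvection x (unit_vec n (n - 1)) =
        transvection x (unit_vec n (n - 1))"
      by (intro transvection_idempotent) (auto simp: x_def)
    define F where "F = mat n n (\<lambda>(i, j). unit_vec n (n - 1) $ i * f $ j)"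
    have "f \<bullet> unit_vec n (n - 1) = 1" using n by (simp add: f_def)
    then have F: "F * F = F" unfolding F_def by (intro outer_product_idempotent) (auto simp: f_def)
    have "transvection x (unit_vec n (n - 1)) + F \<in> P_set k n"
      using E F k by (intro idempotent_sum_mem_P_set) (auto simp: x_def F_def)
    moreover have "transvection x (unit_vec n (n - 1)) + F =
        mat n n (\<lambda>(i, j). if i = j \<or> i = n - 1 \<and> j = n - 2 then 1
                    else if i = n - 2 \<and> j = n - 1 then b else 0)"
    proof (rule eq_matI, goal_cases)
      case (1 i j)
      then have ij: "i < n" "j < n" by auto
      define m where "m = n - 2"
      then have m: "n = Suc (Suc m)" using n by simp
      have nm: "n - 1 = Suc m" "n - 2 = m" using m by auto
      have xi: "x $ i = (if i = Suc m then - 1 else if i = m then b else 0)"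
        and fj: "f $ j = (if j = Suc m \<or> j = m then 1 else 0)"
        and u: "unit_vec n (Suc m) $ i = (if i = Suc m then 1 else (0::'a))"
          "unit_vec n (Suc m) $ j = (if j = Suc m then 1 else (0::'a))"
        using ij m by (simp_all add: x_def f_def nm)
      have "dim_vec x = n" by (simp add: x_def)
      then have "(transvection x (unit_vec n (n - 1)) + F) $$ (i, j) =
          (if i = j then 1 else 0) + x $ i * unit_vec n (Suc m) $ j + unit_vec n (Suc m) $ i * f $ j"
        using ij unfolding F_def transvection_def nm by simp
      also have "\<dots> = (if i = j \<or> i = Suc m \<and> j = m then 1 else if i = m \<and> j = Suc m then b else 0)"
        unfolding xi fj u by simp
      finally show ?case using ij unfolding nm by simp
    qed (simp_all add: F_def)
    ultimately show "mat n n (\<lambda>(i, j). if i = j \<or> i = n - 1 \<and> j = n - 2 then 1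
                    else if i = n - 2 \<and> j = n - 1 then b else 0) \<in> P_set k n" by simp
  qed
qed

lemma diagonal_2_mem_Q_set:
  fixes X :: "'a::{field, finite} mat"
  assumes X: "X \<in> carrier_mat n n" "\<And>i. i < n \<Longrightarrow> X $$ (i, i) = 2"
    and p: "of_nat p = (0::'a)" "p > 0" and k: "k > 0" "coprime k p"
  shows "X \<in> Q_set k n"
proof -
  define U where "U = mat n n (\<lambda>(i, j). if i = j then 1 else if i < j then X $$ (i, j) else 0)"
  define L where "L = mat n n (\<lambda>(i, j). if i = j then 1 else if j < i then X $$ (i, j) else 0)"
  \<comment> \<open>The lower triangular part is handled through its transpose, and its root is
    transposed back.\<close>
  have "unitriangular n 1 U" "unitriangular n 1 (L\<^sup>T)" by (auto simp: unitriangular_def U_def L_def)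
  then obtain A B where A: "A \<in> GL n" "A ^\<^sub>m k = U" and B: "B \<in> GL n" "B ^\<^sub>m k = L\<^sup>T"
    using unitriangular_root[OF _ p k] by metis
  have "B \<in> carrier_mat n n" using B by (simp add: GL_def)
  then have "(B\<^sup>T) ^\<^sub>m k = L" using pow_mat_transpose B by (metis transpose_transpose)
  moreover have "X = U + L"
  proof (rule eq_matI, goal_cases)
    case (1 i j)
    then have ij: "i < n" "j < n" by (auto simp: U_def L_def)
    then show ?case using X by (cases i j rule: linorder_cases) (auto simp: U_def L_def)
  qed (use X in \<open>auto simp: U_def L_def\<close>)
  ultimately show ?thesis using A GL_transpose[OF B(1)] unfolding Q_set_def by blast
qed

text \<open>By Bezout some multiple of \<open>k\<close> is congruent to the gcd modulo q - 1, and
  exponents of nonzero elements only matter modulo q - 1.\<close>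

lemma minus_1_power_gcd:
  assumes x: "(x :: 'a::{field, finite}) ^ gcd k (CARD('a) - 1) = - 1" and k: "k > 0"
  shows "\<exists>y::'a. y ^ k = - 1"
proof -
  have x0: "x \<noteq> 0"
  proof
    assume "x = 0"
    then show False using x k by (simp add: power_0_left split: if_splits)
  qed
  obtain a b where ab: "k * a = (CARD('a) - 1) * b + gcd k (CARD('a) - 1)"
    using bezout_nat[of k "CARD('a) - 1"] k by auto
  have "(x ^ a) ^ k = x ^ (k * a)" by (simp add: mult.commute flip: power_mult)
  also have "\<dots> = (x ^ (CARD('a) - 1)) ^ b * x ^ gcd k (CARD('a) - 1)"
    unfolding ab by (simp only: power_add power_mult)
  also have "\<dots> = - 1" unfolding power_CARD_minus_1[OF x0] x by simp
  finally show ?thesis by blast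
qed

lemma ex_square_ne_1:
  assumes "CARD('a::{field, finite}) \<ge> 4"
  shows "\<exists>r::'a. r \<noteq> 0 \<and> r\<^sup>2 \<noteq> 1"
proof (rule ccontr)
  assume "\<not> ?thesis"
  then have "(UNIV :: 'a set) \<subseteq> {0, 1, - 1}" by (auto simp: power2_eq_1_iff)
  then have "CARD('a) \<le> card {0, 1, - 1 :: 'a}" by (intro card_mono) auto
  also have "\<dots> \<le> 3" by (simp add: card_insert_if)
  finally show False using assms by simp
qed

text \<open>The hypothesis leaves two sets, all matrices or all nonzero ones; an invertible factor
  permutes either. Both cases serve the easy directions of the equivalences.\<close>

lemma left_stabilizer_if_contains_nonzero:
  assumes g: "g \<in> carrier_mat n n" "g' \<in> carrier_mat n n" "g * g' = 1\<^sub>m n"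
    and S: "S \<union> {0\<^sub>m n n} = carrier_mat n n"
  shows "g \<in> left_stabilizer n S"
proof -
  have Sc: "S \<subseteq> carrier_mat n n" using S by blast
  have g'g: "g' * g = 1\<^sub>m n" using mat_mult_left_right_inverse g by blast
  have act: "h * s \<in> S" if h: "h \<in> carrier_mat n n" "h' \<in> carrier_mat n n" "h' * h = 1\<^sub>m n" and s: "s \<in> S"
    for h h' s
  proof (rule ccontr)
    have sc: "s \<in> carrier_mat n n" using s Sc by blast
    \<comment> \<open>The product must then be 0, so \<open>s\<close> is 0 as well and equals
      \<open>h * s\<close>, although \<open>s\<close> lies in \<open>S\<close>.\<close>
    assume "h * s \<notin> S"
    moreover have "h * s \<in> S \<union> {0\<^sub>m n n}" unfolding S using h sc by simp
    ultimately have hs: "h * s = 0\<^sub>m n n" by blast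
    have "s = (h' * h) * s" unfolding h(3) using sc by simp
    also have "\<dots> = h' * (h * s)" using h(1,2) sc by (simp add: assoc_mult_mat[of _ n n _ n _ n])
    also have "\<dots> = 0\<^sub>m n n" unfolding hs using h by simp
    finally have "s = h * s" using hs by simp
    with \<open>h * s \<notin> S\<close> s show False by simp
  qed
  show ?thesis unfolding left_stabilizer_iff[OF Sc]
    using g g'g act[of g g'] act[of g' g] by blast
qed

theorem theorem1p1:
  fixes p l q n k :: nat and g :: "'a :: {field, finite} mat"
  assumes "prime p" and "q = p ^ l" and "CARD('a) = q"
    and "n \<ge> 2" and "k \<ge> 1"
    and "(n, q) \<notin> {(2, 2), (2, 3)}"
    and "g \<in> SL n - SL_center n"
  shows "((P_set k n :: 'a mat set) = carrier_mat n n \<longleftrightarrow> g \<in> left_stabilizer n (P_set k n))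
    \<and> (\<not> p dvd k \<and> (- 1 :: 'a) \<in> {x ^ gcd k (q - 1) | x. True} \<longrightarrow>
        ((Q_set k n :: 'a mat set) = carrier_mat n n \<longleftrightarrow> g \<in> left_stabilizer n (Q_set k n)))
    \<and> (\<not> p dvd k \<longrightarrow>
        ((Q_set k n :: 'a mat set) \<union> {0\<^sub>m n n} = carrier_mat n n \<longleftrightarrow> g \<in> left_stabilizer n (Q_set k n)))"
proof -
  let ?P = "P_set k n :: 'a mat set" and ?Q = "Q_set k n :: 'a mat set"
  have p0: "of_nat p = (0::'a)"
    using of_nat_CARD_eq_0[where ?'a = 'a] assms(2,3) by simp
  have p: "p > 0" using assms(1) prime_gt_0_nat by blast
  have g: "g \<in> carrier_mat n n" "det g = 1" using assms(7) by (auto simp: SL_def)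
  have gg': "adj_mat g \<in> carrier_mat n n" "g * adj_mat g = 1\<^sub>m n"
    using adj_mat[OF g(1)] g(2) by auto
  have nonscalar: "g \<noteq> a \<cdot>\<^sub>m 1\<^sub>m n" for a
  proof
    assume ga: "g = a \<cdot>\<^sub>m 1\<^sub>m n"
    then have "a ^ n = 1" using g(2) by simp
    then show False using assms(7) ga by (auto simp: SL_center_def)
  qed
  have n: "n \<ge> 3 \<or> n = 2 \<and> (\<exists>r::'a. r \<noteq> 0 \<and> r\<^sup>2 \<noteq> 1)"
  proof (cases "n \<ge> 3")
    case False
    then have n2: "n = 2" using assms(4) by simp
    \<comment> \<open>A field has at least two elements, so excluding the orders 2 and 3 leaves at
      least 4.\<close>
    have "card {0, 1 :: 'a} \<le> CARD('a)" by (intro card_mono) auto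
    then have "CARD('a) \<ge> 4" using assms(3,6) n2 by auto
    then show ?thesis using n2 ex_square_ne_1[where ?'a = 'a] by blast
  qed simp
  have P: "?P = carrier_mat n n" if "g \<in> left_stabilizer n ?P"
  proof (rule P_set_eq_carrier[OF _ assms(4,5)])
    show "shear_closed n ?P"
      unfolding P_set_eq_power_sums
    proof (rule power_sums_shear_closed[OF _ _ _ _ nonscalar n])
      show "g \<in> left_stabilizer n (power_sums k (carrier_mat n n))"
        using that unfolding P_set_eq_power_sums .
    qed (auto simp: mult_carrier_mat[of _ n n _ n])
  qed
  have Q_carrier: "?Q \<subseteq> carrier_mat n n"
    unfolding Q_set_eq_power_sums by (rule power_sums_carrier) (auto simp: GL_def)
  have Q: "?Q \<union> {0\<^sub>m n n} = carrier_mat n n" if "\<not> p dvd k" "g \<in> left_stabilizer n ?Q"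
  proof -
    have "shear_closed n ?Q"
      unfolding Q_set_eq_power_sums
    proof (rule power_sums_shear_closed[OF _ GL_transpose GL_conjugate _ nonscalar n])
      show "g \<in> left_stabilizer n (power_sums k (GL n))"
        using that(2) unfolding Q_set_eq_power_sums .
    qed (auto simp: GL_def)
    then interpret shear_closed n ?Q .
    have k: "k > 0" "coprime k p"
      using assms(1,5) that(1) prime_imp_coprime[of p k] by (auto simp: coprime_commute)
    have "X \<in> ?Q" if "X \<in> carrier_mat n n" "X \<noteq> 0\<^sub>m n n" for X
      using nonzero_subset[OF assms(4) diagonal_2_mem_Q_set[OF _ _ p0 p k] that] by blast
    then show ?thesis using Q_carrier by auto
  qed
  \<comment> \<open>If y^k = -1, the identity and the scalar matrix y I are invertible, and their
    \<open>k\<close>-th powers cancel.\<close>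
  have zero: "0\<^sub>m n n \<in> ?Q" if h: "(- 1 :: 'a) \<in> {x ^ gcd k (q - 1) | x. True}"
  proof -
    obtain x :: 'a where "x ^ gcd k (CARD('a) - 1) = - 1" using h assms(3) by auto
    then obtain y :: 'a where y: "y ^ k = - 1" using minus_1_power_gcd assms(5) by fastforce
    have y0: "y \<noteq> 0" using y assms(5) by (auto simp: power_0_left)
    have "y \<cdot>\<^sub>m 1\<^sub>m n * ((1 / y) \<cdot>\<^sub>m 1\<^sub>m n) = 1\<^sub>m n"
      using y0 by (intro eq_matI) auto
    then have "y \<cdot>\<^sub>m 1\<^sub>m n \<in> GL n" unfolding GL_iff by auto
    moreover have "1\<^sub>m n \<in> (GL n :: 'a mat set)" unfolding GL_iff by auto
    moreover have "1\<^sub>m n ^\<^sub>m k + (y \<cdot>\<^sub>m 1\<^sub>m n) ^\<^sub>m k = 0\<^sub>m n n"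
      unfolding pow_mat_one pow_mat_scalar y by (intro eq_matI) auto
    ultimately show ?thesis unfolding Q_set_def by (smt (verit) mem_Collect_eq)
  qed
  note stab = left_stabilizer_if_contains_nonzero[OF g(1) gg']
  show ?thesis
  proof (intro conjI impI)
    show "?P = carrier_mat n n \<longleftrightarrow> g \<in> left_stabilizer n ?P"
    proof
      assume "?P = carrier_mat n n"
      then have "?P \<union> {0\<^sub>m n n} = carrier_mat n n" by (simp add: insert_absorb)
      then show "g \<in> left_stabilizer n ?P" by (rule stab)
    qed (rule P)
    show "?Q = carrier_mat n n \<longleftrightarrow> g \<in> left_stabilizer n ?Q"
      if h: "\<not> p dvd k \<and> (- 1 :: 'a) \<in> {x ^ gcd k (q - 1) | x. True}"
    proof
      assume "g \<in> left_stabilizer n ?Q"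
      then have "?Q \<union> {0\<^sub>m n n} = carrier_mat n n" using Q h by blast
      then show "?Q = carrier_mat n n" using zero h by blast
    next
      assume "?Q = carrier_mat n n"
      then have "?Q \<union> {0\<^sub>m n n} = carrier_mat n n" by (simp add: insert_absorb)
      then show "g \<in> left_stabilizer n ?Q" by (rule stab)
    qed
    show "?Q \<union> {0\<^sub>m n n} = carrier_mat n n \<longleftrightarrow> g \<in> left_stabilizer n ?Q" if "\<not> p dvd k"
      using Q[OF that] stab[of ?Q] by blast
  qed
qed

end
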